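(* Let $\mathbb{K}$ be an algebraically closed field of characteristic zero, let $k\ge 1$ and $m\ge 2$, let $L_{(k)}(m)$ be the free $k$-step nilpotent Lie algebra over $\mathbb{K}$ on $m$ generators, and let $n=\dim L_{(k)}(m)$. Then $L_{(k)}(m)$ is rigid in $\mathcal{N}_{n,k}$.
   Context: $L_{(k)}(m)=L(m)/L^{k+1}(m)$, where $L(m)$ is the free Lie algebra over $\mathbb{K}$ on $m$ generators and $L^{k+1}(m)$ is the $(k+1)$-th term of its descending central series ($L^1=L$, $L^{i+1}=[L^i,L]$). For a bracket $\mu$, set $\mu^1=\mu$ and $\mu^{j}(x_1,\dots,x_{j+1})=\mu(\mu^{j-1}(x_1,\dots,x_j),x_{j+1})$. $\mathcal{N}_{n,k}$ is the affine algebraic variety (with Zariski topology) of all Lie brackets $\mu:\mathbb{K}^n\times\mathbb{K}^n\to\mathbb{K}^n$ with $\mu^k=0$, i.e. nilpotent of nilpotency index at most $k$. $\operatorname{GL}_n(\mathbb{K})$ acts by change of basis, $(g\cdot\mu)(x,y)=g\mu(g^{-1}x,g^{-1}y)$, and the orbits are the isomorphism classes. A Lie bracket $\mu\in\mathcal{N}_{n,k}$ is rigid in $\mathcal{N}_{n,k}$ if its orbit is Zariski open in $\mathcal{N}_{n,k}$. A Lie algebra of dimension $n$ is identified with its bracket via any choice of basis. *)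

theory Defs
  imports
    "HOL-Analysis.Analysis"
    "HOL-Computational_Algebra.Polynomial"
    "HOL-Library.Poly_Mapping"
begin

section \<open>Nonassociative algebras with explicit carrier\<close>

text \<open>
  Vector spaces over \<open>'k\<close> with a bilinear product, whose underlying set need not be a type:
  the free nilpotent Lie algebras below are successive quotients depending on numbers.
\<close>

record ('k, 'v) na_algebra =
  acarrier :: "'v set"
  aplus :: "'v \<Rightarrow> 'v \<Rightarrow> 'v"
  azero :: 'v
  ascale :: "'k \<Rightarrow> 'v \<Rightarrow> 'v"
  abracket :: "'v \<Rightarrow> 'v \<Rightarrow> 'v"

definition asubspace :: "('k, 'v) na_algebra \<Rightarrow> 'v set \<Rightarrow> bool" where
  "asubspace A W \<longleftrightarrow> W \<subseteq> acarrier A \<and> azero A \<in> W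
     \<and> (\<forall>x\<in>W. \<forall>y\<in>W. aplus A x y \<in> W) \<and> (\<forall>c. \<forall>x\<in>W. ascale A c x \<in> W)"

definition aideal :: "('k, 'v) na_algebra \<Rightarrow> 'v set \<Rightarrow> bool" where
  "aideal A I \<longleftrightarrow> asubspace A I
     \<and> (\<forall>x\<in>I. \<forall>y\<in>acarrier A. abracket A x y \<in> I \<and> abracket A y x \<in> I)"

definition aspan :: "('k, 'v) na_algebra \<Rightarrow> 'v set \<Rightarrow> 'v set" where
  "aspan A S = \<Inter> {W. asubspace A W \<and> S \<subseteq> W}"

definition aideal_gen :: "('k, 'v) na_algebra \<Rightarrow> 'v set \<Rightarrow> 'v set" where
  "aideal_gen A S = \<Inter> {I. aideal A I \<and> S \<subseteq> I}"

definition abasis :: "('k, 'v) na_algebra \<Rightarrow> 'v set \<Rightarrow> bool" where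
  "abasis A B \<longleftrightarrow> B \<subseteq> acarrier A \<and> aspan A B = acarrier A
     \<and> (\<forall>b\<in>B. b \<notin> aspan A (B - {b}))"

text \<open>As for \<open>card\<close> and the library's \<open>dim\<close>, the value is 0 in the infinite-dimensional case.\<close>

definition adim :: "('k, 'v) na_algebra \<Rightarrow> nat" where
  "adim A = card (SOME B. abasis A B)"

definition acoset :: "('k, 'v) na_algebra \<Rightarrow> 'v set \<Rightarrow> 'v \<Rightarrow> 'v set" where
  "acoset A W x = {aplus A x w | w. w \<in> W}"

text \<open>
  The quotient by an ideal. The operations collect all representatives; the unions are single
  cosets because the class of the result does not depend on them.
\<close>

definition aquotient :: "('k, 'v) na_algebra \<Rightarrow> 'v set \<Rightarrow> ('k, 'v set) na_algebra" where
  "aquotient A I =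
     \<lparr>acarrier = acoset A I ` acarrier A,
      aplus = (\<lambda>X Y. \<Union>x\<in>X. \<Union>y\<in>Y. acoset A I (aplus A x y)),
      azero = I,
      ascale = (\<lambda>c X. \<Union>x\<in>X. acoset A I (ascale A c x)),
      abracket = (\<lambda>X Y. \<Union>x\<in>X. \<Union>y\<in>Y. acoset A I (abracket A x y))\<rparr>"

text \<open>
  \<open>lower_central A i\<close> is \<open>A\<^sup>i\<close> in the indexing \<open>A\<^sup>1 = A\<close>, \<open>A\<^sup>i\<^sup>+\<^sup>1 = [A\<^sup>i, A]\<close>; the value at
  index 0 is a dummy.
\<close>

fun lower_central :: "('k, 'v) na_algebra \<Rightarrow> nat \<Rightarrow> 'v set" where
  "lower_central A 0 = acarrier A"
| "lower_central A (Suc 0) = acarrier A"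
| "lower_central A (Suc (Suc i)) =
     aspan A {abracket A x y | x y. x \<in> lower_central A (Suc i) \<and> y \<in> acarrier A}"

definition aisomorphic :: "('k, 'v) na_algebra \<Rightarrow> ('k, 'w) na_algebra \<Rightarrow> bool" where
  "aisomorphic A B \<longleftrightarrow> (\<exists>\<phi>. bij_betw \<phi> (acarrier A) (acarrier B)
     \<and> (\<forall>x\<in>acarrier A. \<forall>y\<in>acarrier A. \<phi> (aplus A x y) = aplus B (\<phi> x) (\<phi> y))
     \<and> (\<forall>c. \<forall>x\<in>acarrier A. \<phi> (ascale A c x) = ascale B c (\<phi> x))
     \<and> (\<forall>x\<in>acarrier A. \<forall>y\<in>acarrier A. \<phi> (abracket A x y) = abracket B (\<phi> x) (\<phi> y)))"


section \<open>Free and free nilpotent Lie algebras\<close>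

text \<open>
  Nonassociative words, i.e. the free magma on \<open>'g\<close>. The free nonassociative algebra on
  \<open>{..<m}\<close> has as basis the words whose letters (\<open>set_magma\<close>) are below \<open>m\<close>.
\<close>

datatype 'g magma = Gen 'g | Br "'g magma" "'g magma"

definition free_mult ::
  "('g magma \<Rightarrow>\<^sub>0 'k::field) \<Rightarrow> ('g magma \<Rightarrow>\<^sub>0 'k) \<Rightarrow> ('g magma \<Rightarrow>\<^sub>0 'k)" where
  "free_mult p q = (\<Sum>s\<in>Poly_Mapping.keys p. \<Sum>t\<in>Poly_Mapping.keys q.
     Poly_Mapping.single (Br s t) (Poly_Mapping.lookup p s * Poly_Mapping.lookup q t))"

definition free_algebra :: "nat \<Rightarrow> ('k::field, nat magma \<Rightarrow>\<^sub>0 'k) na_algebra" where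
  "free_algebra m =
     \<lparr>acarrier = {p. \<forall>t\<in>Poly_Mapping.keys p. set_magma t \<subseteq> {..<m}},
      aplus = (+),
      azero = 0,
      ascale = (\<lambda>c. Poly_Mapping.map ((*) c)),
      abracket = free_mult\<rparr>"

definition lie_relators :: "nat \<Rightarrow> (nat magma \<Rightarrow>\<^sub>0 'k::field) set" where
  "lie_relators m =
     {free_mult x x | x. x \<in> acarrier (free_algebra m)} \<union>
     {free_mult (free_mult x y) z + free_mult (free_mult y z) x + free_mult (free_mult z x) y
       | x y z. x \<in> acarrier (free_algebra m) \<and> y \<in> acarrier (free_algebra m)
              \<and> z \<in> acarrier (free_algebra m)}"

definition free_lie :: "nat \<Rightarrow> ('k::field, (nat magma \<Rightarrow>\<^sub>0 'k) set) na_algebra" where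
  "free_lie m = aquotient (free_algebra m) (aideal_gen (free_algebra m) (lie_relators m))"

definition free_nilpotent ::
  "nat \<Rightarrow> nat \<Rightarrow> ('k::field, (nat magma \<Rightarrow>\<^sub>0 'k) set set) na_algebra" where
  "free_nilpotent k m = aquotient (free_lie m) (lower_central (free_lie m) (k + 1))"


section \<open>The variety of nilpotent Lie brackets\<close>

type_synonym ('k, 'n) bracket = "'k ^ 'n \<Rightarrow> 'k ^ 'n \<Rightarrow> 'k ^ 'n"

definition lie_bracket :: "('k::field, 'n::finite) bracket \<Rightarrow> bool" where
  "lie_bracket \<mu> \<longleftrightarrow>
     (\<forall>x. Vector_Spaces.linear (*s) (*s) (\<lambda>y. \<mu> x y)) \<and>
     (\<forall>y. Vector_Spaces.linear (*s) (*s) (\<lambda>x. \<mu> x y)) \<and>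
     (\<forall>x. \<mu> x x = 0) \<and>
     (\<forall>x y z. \<mu> (\<mu> x y) z + \<mu> (\<mu> y z) x + \<mu> (\<mu> z x) y = 0)"

text \<open>
  \<open>iterated_bracket \<mu> j x\<close> is \<open>\<mu>\<^sup>j\<close> at the \<open>j + 1\<close> arguments \<open>x 0, \<dots>, x j\<close>; starting the
  recursion at the identity \<open>\<mu>\<^sup>0\<close> gives \<open>\<mu>\<^sup>1 = \<mu>\<close>.
\<close>

primrec iterated_bracket ::
  "('k, 'n) bracket \<Rightarrow> nat \<Rightarrow> (nat \<Rightarrow> 'k ^ 'n) \<Rightarrow> 'k ^ 'n" where
  "iterated_bracket \<mu> 0 x = x 0"
| "iterated_bracket \<mu> (Suc j) x = \<mu> (iterated_bracket \<mu> j x) (x (Suc j))"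

definition nilpotent_brackets :: "nat \<Rightarrow> ('k::field, 'n::finite) bracket set" where
  "nilpotent_brackets k = {\<mu>. lie_bracket \<mu> \<and> (\<forall>x. iterated_bracket \<mu> k x = 0)}"

definition bracket_algebra :: "('k::field, 'n::finite) bracket \<Rightarrow> ('k, 'k ^ 'n) na_algebra" where
  "bracket_algebra \<mu> =
     \<lparr>acarrier = UNIV, aplus = (+), azero = 0, ascale = (*s), abracket = \<mu>\<rparr>"

definition gl_action ::
  "'k::field ^ 'n ^ 'n \<Rightarrow> ('k, 'n::finite) bracket \<Rightarrow> ('k, 'n) bracket" where
  "gl_action g \<mu> = (\<lambda>x y. g *v \<mu> (matrix_inv g *v x) (matrix_inv g *v y))"

definition gl_orbit :: "('k::field, 'n::finite) bracket \<Rightarrow> ('k, 'n) bracket set" where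
  "gl_orbit \<mu> = {gl_action g \<mu> | g. invertible g}"


section \<open>Zariski topology and rigidity\<close>

definition peval :: "(('i \<Rightarrow>\<^sub>0 nat) \<Rightarrow>\<^sub>0 'k::field) \<Rightarrow> ('i::finite \<Rightarrow> 'k) \<Rightarrow> 'k" where
  "peval f x = (\<Sum>a\<in>Poly_Mapping.keys f.
     Poly_Mapping.lookup f a * (\<Prod>i\<in>UNIV. x i ^ Poly_Mapping.lookup a i))"

text \<open>The open sets are the complements of common zero loci of sets of polynomials.\<close>

definition zariski :: "('i::finite \<Rightarrow> 'k::field) topology" where
  "zariski = topology (\<lambda>U. \<exists>S. U = - {x. \<forall>f\<in>S. peval f x = 0})"

lemma peval_superset:
  assumes "finite A" "Poly_Mapping.keys f \<subseteq> A"
  shows "peval f x = (\<Sum>a\<in>A.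
     Poly_Mapping.lookup f a * (\<Prod>i\<in>UNIV. x i ^ Poly_Mapping.lookup a i))"
  unfolding peval_def
  by (rule sum.mono_neutral_left) (use assms in \<open>auto simp: in_keys_iff\<close>)

lemma peval_add: "peval (f + g) x = peval f x + peval g x"
proof -
  let ?A = "Poly_Mapping.keys f \<union> Poly_Mapping.keys g"
  have "Poly_Mapping.keys (f + g) \<subseteq> ?A"
    by (rule Poly_Mapping.keys_add)
  then show ?thesis
    by (simp add: peval_superset[of ?A] lookup_add sum.distrib distrib_right)
qed

lemma peval_0 [simp]: "peval 0 x = 0"
  by (simp add: peval_def)

lemma peval_sum: "peval (\<Sum>j\<in>J. f j) x = (\<Sum>j\<in>J. peval (f j) x)"
  by (induction J rule: infinite_finite_induct) (auto simp: peval_add)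

lemma peval_single:
  "peval (Poly_Mapping.single a c) x = c * (\<Prod>i\<in>UNIV. x i ^ Poly_Mapping.lookup a i)"
  by (subst peval_superset[of "{a}"]) auto

lemma poly_mapping_eq_sum_single:
  "f = (\<Sum>a\<in>Poly_Mapping.keys f. Poly_Mapping.single a (Poly_Mapping.lookup f a))"
  by (rule poly_mapping_eqI)
    (auto simp: lookup_sum lookup_single when_def in_keys_iff)

lemma peval_mult: "peval (f * g) x = peval f x * peval g x"
proof -
  let ?s = "\<lambda>h a. Poly_Mapping.single a (Poly_Mapping.lookup h a)"
  have "f * g = (\<Sum>a\<in>Poly_Mapping.keys f. ?s f a) * (\<Sum>b\<in>Poly_Mapping.keys g. ?s g b)"
    by (simp flip: poly_mapping_eq_sum_single)
  also have "\<dots> = (\<Sum>a\<in>Poly_Mapping.keys f. \<Sum>b\<in>Poly_Mapping.keys g.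
      Poly_Mapping.single (a + b) (Poly_Mapping.lookup f a * Poly_Mapping.lookup g b))"
    by (simp only: sum_product mult_single)
  finally have "peval (f * g) x = (\<Sum>a\<in>Poly_Mapping.keys f. \<Sum>b\<in>Poly_Mapping.keys g.
      peval (Poly_Mapping.single (a + b) (Poly_Mapping.lookup f a * Poly_Mapping.lookup g b)) x)"
    by (simp only: peval_sum)
  then show ?thesis
    by (simp add: peval_single peval_def[of f] peval_def[of g] sum_product
        lookup_add power_add prod.distrib mult.assoc mult.left_commute)
qed

lemma istopology_zariski:
  "istopology (\<lambda>U::('i::finite \<Rightarrow> 'k::field) set. \<exists>S. U = - {x. \<forall>f\<in>S. peval f x = 0})"
  unfolding istopology_def
proof (intro conjI allI impI)
  fix U V :: "('i \<Rightarrow> 'k) set"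
  assume "\<exists>S. U = - {x. \<forall>f\<in>S. peval f x = 0}" "\<exists>S. V = - {x. \<forall>f\<in>S. peval f x = 0}"
  then obtain S T where "U = - {x. \<forall>f\<in>S. peval f x = 0}" "V = - {x. \<forall>f\<in>T. peval f x = 0}"
    by blast
  then have "U \<inter> V = - {x. \<forall>h\<in>(\<lambda>(f, g). f * g) ` (S \<times> T). peval h x = 0}"
    by (auto simp: peval_mult)
  then show "\<exists>S. U \<inter> V = - {x. \<forall>f\<in>S. peval f x = 0}"
    by blast
next
  fix \<U> :: "('i \<Rightarrow> 'k) set set"
  define D where "D S = - {x :: 'i \<Rightarrow> 'k. \<forall>f\<in>S. peval f x = 0}" for S
  assume "\<forall>U\<in>\<U>. \<exists>S. U = - {x. \<forall>f\<in>S. peval f x = 0}"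
  then have "\<forall>U\<in>\<U>. \<exists>S. U = D S"
    by (simp only: D_def)
  then have "\<exists>S. \<forall>U\<in>\<U>. U = D (S U)"
    by (rule bchoice)
  then obtain S where S: "\<forall>U\<in>\<U>. U = D (S U)" ..
  have "\<Union>\<U> = (\<Union>U\<in>\<U>. D (S U))"
    using SUP_cong[OF refl, of \<U> "\<lambda>U. U" "\<lambda>U. D (S U)"] S by (metis image_ident)
  also have "\<dots> = D (\<Union>U\<in>\<U>. S U)"
    by (auto simp: D_def)
  finally show "\<exists>S. \<Union>\<U> = - {x. \<forall>f\<in>S. peval f x = 0}"
    unfolding D_def by (rule exI)
qed

lemma openin_zariski: "openin zariski U \<longleftrightarrow> (\<exists>S. U = - {x. \<forall>f\<in>S. peval f x = 0})"
  unfolding zariski_def by (simp add: topology_inverse'[OF istopology_zariski])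

text \<open>
  The coordinates in which the brackets form an affine variety; a bilinear map is determined by
  them.
\<close>

definition structure_constants ::
  "('k::field, 'n::finite) bracket \<Rightarrow> 'n \<times> 'n \<times> 'n \<Rightarrow> 'k" where
  "structure_constants \<mu> = (\<lambda>(i, j, l). \<mu> (axis i 1) (axis j 1) $ l)"

definition rigid :: "nat \<Rightarrow> ('k::field, 'n::finite) bracket \<Rightarrow> bool" where
  "rigid k \<mu> \<longleftrightarrow> \<mu> \<in> nilpotent_brackets k \<and>
     openin (subtopology zariski (structure_constants ` nilpotent_brackets k))
       (structure_constants ` gl_orbit \<mu>)"

end

theory Submission
  imports Defs
begin

text \<open>
  Choose words \<open>w\<^sub>1, \<dots>, w\<^sub>n\<close> in the generators whose classes form a basis of the free nilpotent
  Lie algebra. If \<open>\<nu>\<close> is any bracket in the variety and \<open>x\<^sub>1, \<dots>, x\<^sub>m\<close> are vectors, then the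
  free algebra maps to \<open>\<nu>\<close> by sending the generators to the \<open>x\<^sub>j\<close>, and, as the dimensions
  agree, this map is an isomorphism as soon as the vectors \<open>w\<^sub>i(x\<^sub>1, \<dots>, x\<^sub>m)\<close>, computed in \<open>\<nu>\<close>, are
  linearly independent. For fixed \<open>x\<close> the determinant of these vectors is a polynomial in the
  structure constants of \<open>\<nu>\<close>, so the orbit is the union over \<open>x\<close> of the principal open subsets
  on which such a determinant does not vanish.
\<close>

section \<open>The free nonassociative algebra\<close>

abbreviation pscale :: "'k::field \<Rightarrow> ('a \<Rightarrow>\<^sub>0 'k) \<Rightarrow> ('a \<Rightarrow>\<^sub>0 'k)" where
  "pscale c \<equiv> Poly_Mapping.map ((*) c)"

abbreviation word :: "'g magma \<Rightarrow> ('g magma \<Rightarrow>\<^sub>0 'k::field)" where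
  "word t \<equiv> Poly_Mapping.single t 1"

abbreviation free_carrier :: "nat \<Rightarrow> (nat magma \<Rightarrow>\<^sub>0 'k::field) set" where
  "free_carrier m \<equiv> acarrier (free_algebra m)"

abbreviation words :: "nat \<Rightarrow> (nat magma \<Rightarrow>\<^sub>0 'k::field) set" where
  "words m \<equiv> word ` {t. set_magma t \<subseteq> {..<m}}"

lemma lookup_pscale [simp]: "Poly_Mapping.lookup (pscale c p) t = c * Poly_Mapping.lookup p t"
  by (auto simp: Poly_Mapping.map.rep_eq when_def)

lemma pscale_single [simp]: "pscale c (Poly_Mapping.single t d) = Poly_Mapping.single t (c * d)"
  by (rule poly_mapping_eqI) (simp add: lookup_single when_def)

interpretation pm: vector_space "pscale :: 'k::field \<Rightarrow> ('a \<Rightarrow>\<^sub>0 'k) \<Rightarrow> ('a \<Rightarrow>\<^sub>0 'k)"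
  by unfold_locales
    (auto intro!: poly_mapping_eqI simp: lookup_add algebra_simps)

interpretation pm_pm: vector_space_pair
    "pscale :: 'k::field \<Rightarrow> ('a \<Rightarrow>\<^sub>0 'k) \<Rightarrow> ('a \<Rightarrow>\<^sub>0 'k)"
    "pscale :: 'k::field \<Rightarrow> ('b \<Rightarrow>\<^sub>0 'k) \<Rightarrow> ('b \<Rightarrow>\<^sub>0 'k)" ..

interpretation pm_vec: vector_space_pair
    "pscale :: 'k::field \<Rightarrow> ('a \<Rightarrow>\<^sub>0 'k) \<Rightarrow> ('a \<Rightarrow>\<^sub>0 'k)"
    "(*s) :: 'k::field \<Rightarrow> 'k ^ 'n \<Rightarrow> 'k ^ 'n" ..

text \<open>Words outside the supports contribute zero coefficients. With the sums over common
  finite index sets, bilinearity can be read off even though supports change under addition and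
  scaling.\<close>

lemma free_mult_superset:
  assumes "finite S" "Poly_Mapping.keys p \<subseteq> S" "finite T" "Poly_Mapping.keys q \<subseteq> T"
  shows "free_mult p q = (\<Sum>s\<in>S. \<Sum>t\<in>T.
     Poly_Mapping.single (Br s t) (Poly_Mapping.lookup p s * Poly_Mapping.lookup q t))"
proof -
  have "free_mult p q = (\<Sum>s\<in>Poly_Mapping.keys p. \<Sum>t\<in>T.
     Poly_Mapping.single (Br s t) (Poly_Mapping.lookup p s * Poly_Mapping.lookup q t))"
    unfolding free_mult_def
    by (intro sum.cong refl sum.mono_neutral_left) (use assms in \<open>auto simp: in_keys_iff\<close>)
  also have "\<dots> = (\<Sum>s\<in>S. \<Sum>t\<in>T.
     Poly_Mapping.single (Br s t) (Poly_Mapping.lookup p s * Poly_Mapping.lookup q t))"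
    by (intro sum.mono_neutral_left) (use assms in \<open>auto simp: in_keys_iff\<close>)
  finally show ?thesis .
qed

lemma free_mult_add_left: "free_mult (p + p') q = free_mult p q + free_mult p' q"
proof -
  let ?S = "Poly_Mapping.keys p \<union> Poly_Mapping.keys p'"
  have "Poly_Mapping.keys (p + p') \<subseteq> ?S"
    by (rule Poly_Mapping.keys_add)
  then show ?thesis
    by (simp add: free_mult_superset[of ?S _ "Poly_Mapping.keys q"] lookup_add distrib_right
        single_add sum.distrib)
qed

lemma free_mult_add_right: "free_mult p (q + q') = free_mult p q + free_mult p q'"
proof -
  let ?S = "Poly_Mapping.keys q \<union> Poly_Mapping.keys q'"
  have "Poly_Mapping.keys (q + q') \<subseteq> ?S"
    by (rule Poly_Mapping.keys_add)
  then show ?thesis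
    by (simp add: free_mult_superset[of "Poly_Mapping.keys p" _ ?S] lookup_add distrib_left
        single_add sum.distrib)
qed

lemma keys_pscale: "Poly_Mapping.keys (pscale c p) \<subseteq> Poly_Mapping.keys p"
  by (auto simp: in_keys_iff)

lemma free_mult_scale_left: "free_mult (pscale c p) q = pscale c (free_mult p q)"
  by (simp add: free_mult_superset[of "Poly_Mapping.keys p" _ "Poly_Mapping.keys q"] keys_pscale
      pm.scale_sum_right mult.assoc)

lemma free_mult_scale_right: "free_mult p (pscale c q) = pscale c (free_mult p q)"
  by (simp add: free_mult_superset[of "Poly_Mapping.keys p" _ "Poly_Mapping.keys q"] keys_pscale
      pm.scale_sum_right mult.left_commute)

lemma free_mult_word [simp]: "free_mult (word s) (word t) = word (Br s t)"
  by (simp add: free_mult_def)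

section \<open>The carrier of the free algebra as a span of words\<close>

lemma free_algebra_simps [simp]:
  "aplus (free_algebra m) = (+)" "azero (free_algebra m) = 0"
  "ascale (free_algebra m) = pscale" "abracket (free_algebra m) = free_mult"
  by (simp_all add: free_algebra_def)

text \<open>Every element is the sum of its monomials. This makes the carrier a library subspace and
  lets linear statements about it be checked on words.\<close>

lemma free_carrier_eq_span: "free_carrier m = pm.span (words m)"
proof (intro equalityI subsetI)
  fix p :: "nat magma \<Rightarrow>\<^sub>0 'a"
  assume "p \<in> free_carrier m"
  then have "pscale (Poly_Mapping.lookup p t) (word t) \<in> pm.span (words m)"
    if "t \<in> Poly_Mapping.keys p" for t
    using that by (intro pm.span_scale pm.span_base) (auto simp: free_algebra_def)
  then show "p \<in> pm.span (words m)"
    by (subst poly_mapping_eq_sum_single) (auto intro: pm.span_sum)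
next
  have "pm.subspace (free_carrier m :: (nat magma \<Rightarrow>\<^sub>0 'a) set)"
    unfolding pm.subspace_def free_algebra_def
    using Poly_Mapping.keys_add keys_pscale by (fastforce simp: in_keys_iff)
  moreover have "words m \<subseteq> free_carrier m"
    by (auto simp: free_algebra_def)
  ultimately show "p \<in> free_carrier m" if "p \<in> pm.span (words m)" for p :: "nat magma \<Rightarrow>\<^sub>0 'a"
    using that pm.span_minimal by blast
qed

lemma subspace_free_carrier [simp]: "pm.subspace (free_carrier m)"
  by (simp add: free_carrier_eq_span)

lemmas free_carrier_closed [intro, simp] =
  pm.subspace_0[OF subspace_free_carrier] pm.subspace_add[OF subspace_free_carrier]
  pm.subspace_diff[OF subspace_free_carrier] pm.subspace_neg[OF subspace_free_carrier]
  pm.subspace_scale[OF subspace_free_carrier]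

lemma single_in_free_carrier [simp]:
  "set_magma t \<subseteq> {..<m} \<Longrightarrow> Poly_Mapping.single t c \<in> free_carrier m"
  by (auto simp: free_algebra_def)

lemma free_mult_closed [intro, simp]:
  assumes "p \<in> free_carrier m" "q \<in> free_carrier m"
  shows "free_mult p q \<in> free_carrier m"
proof -
  have "Poly_Mapping.single (Br s t) c \<in> free_carrier m"
    if "s \<in> Poly_Mapping.keys p" "t \<in> Poly_Mapping.keys q" for s t c
    using assms that unfolding free_algebra_def by (auto split: if_splits)
  then show ?thesis
    unfolding free_mult_def by (intro pm.subspace_sum[OF subspace_free_carrier])
qed

section \<open>Quotients of the free nonassociative algebra\<close>

text \<open>
  The carriers of the iterated quotients are sets of sets; all computations are done with
  representatives in the free nonassociative algebra instead, where the library's vector spaces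
  are available.
\<close>

locale presentation =
  fixes m :: nat
    and A :: "('k::field, 'v) na_algebra"
    and \<pi> :: "(nat magma \<Rightarrow>\<^sub>0 'k) \<Rightarrow> 'v"
  assumes carrier: "acarrier A = \<pi> ` free_carrier m"
    and zero: "azero A = \<pi> 0"
    and plus: "\<lbrakk>p \<in> free_carrier m; q \<in> free_carrier m\<rbrakk> \<Longrightarrow> aplus A (\<pi> p) (\<pi> q) = \<pi> (p + q)"
    and scale: "p \<in> free_carrier m \<Longrightarrow> ascale A c (\<pi> p) = \<pi> (pscale c p)"
    and bracket: "\<lbrakk>p \<in> free_carrier m; q \<in> free_carrier m\<rbrakk> \<Longrightarrow>
      abracket A (\<pi> p) (\<pi> q) = \<pi> (free_mult p q)"

lemma presentation_free_algebra: "presentation m (free_algebra m) (\<lambda>p. p)"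
  by unfold_locales simp_all

context presentation
begin

text \<open>The kernel of \<pi>.\<close>

definition relations :: "(nat magma \<Rightarrow>\<^sub>0 'k) set" where
  "relations = {p \<in> free_carrier m. \<pi> p = \<pi> 0}"

text \<open>\<open>A\<close> comes without negation or cancellation laws, so both directions add the
  image of a suitable representative, \<open>- q\<close> or \<open>q\<close>, to both sides.\<close>

lemma map_eq_iff:
  assumes "p \<in> free_carrier m" "q \<in> free_carrier m"
  shows "\<pi> p = \<pi> q \<longleftrightarrow> p - q \<in> relations"
proof -
  have "\<pi> (p - q) = \<pi> 0" if "\<pi> p = \<pi> q"
    using assms plus[of p "pscale (- 1) q"] plus[of q "pscale (- 1) q"] that
    by (simp add: pm.scale_minus_left)
  moreover have "\<pi> p = \<pi> q" if "\<pi> (p - q) = \<pi> 0"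
    using assms plus[of "p - q" q] plus[of 0 q] that by simp
  ultimately show ?thesis
    using assms by (auto simp: relations_def)
qed

lemma map_eq_zero_iff: "p \<in> free_carrier m \<Longrightarrow> \<pi> p = \<pi> 0 \<longleftrightarrow> p \<in> relations"
  by (simp add: relations_def)

section \<open>Subspaces, spans and cosets through representatives\<close>

lemma subspace_preimage:
  assumes "asubspace A W"
  shows "pm.subspace {p \<in> free_carrier m. \<pi> p \<in> W}"
  using assms unfolding asubspace_def pm.subspace_def
  by (auto simp: zero simp flip: plus scale)

lemma subspace_relations: "pm.subspace relations"
proof -
  have "asubspace A {\<pi> 0}"
    unfolding asubspace_def
    by (auto simp: carrier zero plus scale)
  from subspace_preimage[OF this] show ?thesis
    by (simp add: relations_def)
qed

lemma asubspace_image: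
  assumes "pm.subspace P" "P \<subseteq> free_carrier m"
  shows "asubspace A (\<pi> ` P)"
  unfolding asubspace_def
proof (intro conjI ballI allI)
  show "azero A \<in> \<pi> ` P"
    using assms pm.subspace_0 by (auto simp: zero)
  fix x y c
  assume "x \<in> \<pi> ` P"
  then obtain p where p: "x = \<pi> p" "p \<in> P" by blast
  show "ascale A c x \<in> \<pi> ` P"
    using p assms by (auto simp: scale pm.subspace_scale subset_iff)
  assume "y \<in> \<pi> ` P"
  then obtain q where q: "y = \<pi> q" "q \<in> P" by blast
  show "aplus A x y \<in> \<pi> ` P"
    using p q assms by (auto simp: plus pm.subspace_add subset_iff)
qed (use assms carrier in auto)

text \<open>Minimality is used twice: images of subspaces under \<pi> are subspaces of
  \<open>A\<close>, and so are preimages in the free algebra. Span computations in \<open>A\<close>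
  thereby become computations with the library's span.\<close>

lemma aspan_image:
  assumes "P \<subseteq> free_carrier m"
  shows "aspan A (\<pi> ` P) = \<pi> ` pm.span P"
proof (intro equalityI)
  have "pm.span P \<subseteq> free_carrier m"
    using assms by (simp add: pm.span_minimal)
  then have "asubspace A (\<pi> ` pm.span P)"
    by (simp add: asubspace_image)
  then show "aspan A (\<pi> ` P) \<subseteq> \<pi> ` pm.span P"
    unfolding aspan_def using pm.span_superset by blast
  show "\<pi> ` pm.span P \<subseteq> aspan A (\<pi> ` P)"
    unfolding aspan_def
  proof (intro Inter_greatest)
    fix W
    assume "W \<in> {W. asubspace A W \<and> \<pi> ` P \<subseteq> W}"
    then have "pm.span P \<subseteq> {p \<in> free_carrier m. \<pi> p \<in> W}"
      using assms subspace_preimage by (intro pm.span_minimal) auto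
    then show "\<pi> ` pm.span P \<subseteq> W"
      by blast
  qed
qed

lemma asubspace_aspan:
  assumes "S \<subseteq> acarrier A"
  shows "asubspace A (aspan A S)"
proof -
  obtain P where "P \<subseteq> free_carrier m" "S = \<pi> ` P"
    using assms by (auto simp: carrier subset_image_iff)
  then show ?thesis
    by (simp add: aspan_image asubspace_image pm.span_minimal)
qed

lemma aspan_superset: "S \<subseteq> aspan A S"
  unfolding aspan_def by blast

lemma aspan_minimal: "\<lbrakk>S \<subseteq> W; asubspace A W\<rbrakk> \<Longrightarrow> aspan A S \<subseteq> W"
  unfolding aspan_def by blast

lemma acoset_eq:
  assumes "asubspace A I" "p \<in> free_carrier m"
  shows "acoset A I (\<pi> p) = \<pi> ` {q \<in> free_carrier m. \<pi> (q - p) \<in> I}"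
proof (intro equalityI subsetI)
  fix x assume "x \<in> acoset A I (\<pi> p)"
  then obtain w where w: "x = aplus A (\<pi> p) w" "w \<in> I"
    by (auto simp: acoset_def)
  then obtain r where "w = \<pi> r" "r \<in> free_carrier m"
    using assms by (auto simp: asubspace_def carrier)
  then show "x \<in> \<pi> ` {q \<in> free_carrier m. \<pi> (q - p) \<in> I}"
    using w assms by (auto simp: plus intro!: image_eqI[of _ _ "p + r"])
next
  fix x assume "x \<in> \<pi> ` {q \<in> free_carrier m. \<pi> (q - p) \<in> I}"
  then obtain q where "x = \<pi> q" "q \<in> free_carrier m" "\<pi> (q - p) \<in> I"
    by blast
  then show "x \<in> acoset A I (\<pi> p)"
    using assms plus[of p "q - p"] by (auto simp: acoset_def intro!: exI[of _ "\<pi> (q - p)"])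
qed

lemma acoset_eq_iff:
  assumes I: "asubspace A I" and pq: "p \<in> free_carrier m" "q \<in> free_carrier m"
  shows "acoset A I (\<pi> p) = acoset A I (\<pi> q) \<longleftrightarrow> \<pi> (p - q) \<in> I"
proof
  have "\<pi> (p - p) \<in> I"
    using I by (simp add: asubspace_def zero)
  then have "\<pi> p \<in> acoset A I (\<pi> p)"
    using pq by (auto simp: acoset_eq I)
  moreover assume "acoset A I (\<pi> p) = acoset A I (\<pi> q)"
  ultimately obtain r where r: "r \<in> free_carrier m" "\<pi> (r - q) \<in> I" "\<pi> p = \<pi> r"
    using pq by (auto simp: acoset_eq I)
  \<comment> \<open>The two arguments differ by \<open>p - r\<close>, which is a relation.\<close>
  then have "\<pi> (p - q) = \<pi> (r - q)"
    using pq map_eq_iff by auto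
  then show "\<pi> (p - q) \<in> I"
    using r by simp
next
  note P = subspace_preimage[OF I]
  assume *: "\<pi> (p - q) \<in> I"
  have "\<pi> (r - p) \<in> I \<longleftrightarrow> \<pi> (r - q) \<in> I" if "r \<in> free_carrier m" for r
    using pm.subspace_add[OF P, of "r - p" "p - q"] pm.subspace_diff[OF P, of "r - q" "p - q"]
      * pq that by auto
  then show "acoset A I (\<pi> p) = acoset A I (\<pi> q)"
    using pq by (auto simp: acoset_eq I)
qed

lemma ideal_mult_left:
  assumes "aideal A I" "p \<in> free_carrier m" "q \<in> free_carrier m" "\<pi> p \<in> I"
  shows "\<pi> (free_mult p q) \<in> I"
  using assms by (auto simp: aideal_def carrier simp flip: bracket)

lemma ideal_mult_right:
  assumes "aideal A I" "p \<in> free_carrier m" "q \<in> free_carrier m" "\<pi> q \<in> I"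
  shows "\<pi> (free_mult p q) \<in> I"
  using assms by (auto simp: aideal_def carrier simp flip: bracket)

text \<open>Quotients of presented algebras are again presented by the same free algebra, so the
  construction can be iterated: first the Lie relators, then a term of the lower central
  series.\<close>

lemma presentation_quotient:
  assumes I: "aideal A I"
  shows "presentation m (aquotient A I) (\<lambda>p. acoset A I (\<pi> p))"
proof -
  have sub: "asubspace A I"
    using I by (simp add: aideal_def)
  note P = subspace_preimage[OF sub]
  note coset = acoset_eq[OF sub] and coset_iff = acoset_eq_iff[OF sub]
  \<comment> \<open>The operations of \<open>aquotient\<close> are unions over all representatives.
    A coset is nonempty, so such a union collapses once every representative gives the same set;
    what remains is well-definedness.\<close>
  have union1: "(\<Union>x\<in>acoset A I (\<pi> p). F x) = G"
    if "p \<in> free_carrier m"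
      "\<And>p'. \<lbrakk>p' \<in> free_carrier m; \<pi> (p' - p) \<in> I\<rbrakk> \<Longrightarrow> F (\<pi> p') = G"
    for p and F :: "'v \<Rightarrow> 'v set" and G
  proof -
    have "p \<in> {q \<in> free_carrier m. \<pi> (q - p) \<in> I}"
      using that sub by (auto simp: asubspace_def zero)
    then have "(\<Union>x\<in>acoset A I (\<pi> p). F x) = (\<Union>q\<in>{q \<in> free_carrier m. \<pi> (q - p) \<in> I}. G)"
      using that by (simp add: coset)
    also have "\<dots> = G"
      using \<open>p \<in> {q \<in> free_carrier m. \<pi> (q - p) \<in> I}\<close> by auto
    finally show ?thesis .
  qed
  show ?thesis
  proof
    show "acarrier (aquotient A I) = (\<lambda>p. acoset A I (\<pi> p)) ` free_carrier m"
      by (simp add: aquotient_def carrier image_image)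
    show "azero (aquotient A I) = acoset A I (\<pi> 0)"
      using sub by (auto simp: aquotient_def coset asubspace_def carrier)
  next
    fix p :: "nat magma \<Rightarrow>\<^sub>0 'k" and c assume p: "p \<in> free_carrier m"
    show "ascale (aquotient A I) c (acoset A I (\<pi> p)) = acoset A I (\<pi> (pscale c p))"
      unfolding aquotient_def na_algebra.simps
    proof (rule union1[OF p])
      fix p' assume p': "p' \<in> free_carrier m" "\<pi> (p' - p) \<in> I"
      then have "\<pi> (pscale c (p' - p)) \<in> I"
        using pm.subspace_scale[OF P, of "p' - p" c] p by auto
      then show "acoset A I (ascale A c (\<pi> p')) = acoset A I (\<pi> (pscale c p))"
        using p p' by (simp add: scale coset_iff pm.scale_right_diff_distrib)
    qed
  next
    fix p q :: "nat magma \<Rightarrow>\<^sub>0 'k"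
    assume p: "p \<in> free_carrier m" and q: "q \<in> free_carrier m"
    show "aplus (aquotient A I) (acoset A I (\<pi> p)) (acoset A I (\<pi> q)) = acoset A I (\<pi> (p + q))"
      unfolding aquotient_def na_algebra.simps
    proof (rule union1[OF p], rule union1[OF q])
      fix p' q'
      assume p': "p' \<in> free_carrier m" "\<pi> (p' - p) \<in> I"
        and q': "q' \<in> free_carrier m" "\<pi> (q' - q) \<in> I"
      then have "\<pi> ((p' - p) + (q' - q)) \<in> I"
        using pm.subspace_add[OF P, of "p' - p" "q' - q"] p q by auto
      then show "acoset A I (aplus A (\<pi> p') (\<pi> q')) = acoset A I (\<pi> (p + q))"
        using p q p' q' by (simp add: plus coset_iff algebra_simps)
    qed
    show "abracket (aquotient A I) (acoset A I (\<pi> p)) (acoset A I (\<pi> q)) =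
        acoset A I (\<pi> (free_mult p q))"
      unfolding aquotient_def na_algebra.simps
    proof (rule union1[OF p], rule union1[OF q])
      fix p' q'
      assume p': "p' \<in> free_carrier m" "\<pi> (p' - p) \<in> I"
        and q': "q' \<in> free_carrier m" "\<pi> (q' - q) \<in> I"
      \<comment> \<open>The change of a product is split so that each summand has one factor in the
        ideal.\<close>
      have "free_mult (p' - p) q' + free_mult p (q' - q) = free_mult p' q' - free_mult p q"
        using free_mult_add_left[of "p' - p" p q'] free_mult_add_right[of p "q' - q" q]
        by simp
      moreover have "\<pi> (free_mult (p' - p) q' + free_mult p (q' - q)) \<in> I"
        using pm.subspace_add[OF P, of "free_mult (p' - p) q'" "free_mult p (q' - q)"]
          ideal_mult_left[OF I, of "p' - p" q'] ideal_mult_right[OF I, of p "q' - q"] p q p' q'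
        by auto
      ultimately show "acoset A I (abracket A (\<pi> p') (\<pi> q')) = acoset A I (\<pi> (free_mult p q))"
        using p q p' q' by (simp add: bracket coset_iff)
    qed
  qed
qed

end

section \<open>The free nilpotent Lie algebra\<close>

locale lie_presentation = presentation +
  assumes lie_relators_subset: "lie_relators m \<subseteq> relations"
begin

lemma square_relation: "p \<in> free_carrier m \<Longrightarrow> free_mult p p \<in> relations"
  using lie_relators_subset by (auto simp: lie_relators_def)

lemma jacobi_relation:
  "\<lbrakk>p \<in> free_carrier m; q \<in> free_carrier m; r \<in> free_carrier m\<rbrakk> \<Longrightarrow>
    free_mult (free_mult p q) r + free_mult (free_mult q r) p + free_mult (free_mult r p) q
      \<in> relations"
  using lie_relators_subset unfolding lie_relators_def by blast

text \<open>Polarization: subtract the squares of \<open>p\<close> and \<open>q\<close> from the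
  square of \<open>p + q\<close>. Negation is written as scaling by \<open>- 1\<close>, the form
  available in \<open>na_algebra\<close>.\<close>

lemma bracket_antisym:
  assumes "x \<in> acarrier A" "y \<in> acarrier A"
  shows "abracket A y x = ascale A (- 1) (abracket A x y)"
proof -
  obtain p q where pq: "x = \<pi> p" "y = \<pi> q" "p \<in> free_carrier m" "q \<in> free_carrier m"
    using assms by (auto simp: carrier)
  have "free_mult (p + q) (p + q) - free_mult p p - free_mult q q \<in> relations"
    using pq by (intro pm.subspace_diff[OF subspace_relations] square_relation) auto
  then have "free_mult q p - pscale (- 1) (free_mult p q) \<in> relations"
    by (simp add: free_mult_add_left free_mult_add_right algebra_simps)
  then show ?thesis
    using pq by (simp add: bracket scale map_eq_iff)
qed

section \<open>The terms of the lower central series are ideals\<close>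

lemma carrier_ideal: "aideal A (acarrier A)"
proof -
  have "asubspace A (acarrier A)"
    by (simp add: carrier asubspace_image)
  then show ?thesis
    unfolding aideal_def by (auto simp: carrier bracket)
qed

lemma lower_central_descends:
  assumes "aideal A (lower_central A (Suc i))"
  shows "lower_central A (Suc (Suc i)) \<subseteq> lower_central A (Suc i)"
  unfolding lower_central.simps by (rule aspan_minimal) (use assms in \<open>auto simp: aideal_def\<close>)

text \<open>If the previous term is an ideal, it contains the next one. The bracket of an element of
  the next term with any element of \<open>A\<close> is then one of the generators of that term.
  Brackets on the other side follow from antisymmetry.\<close>

lemma lower_central_ideal: "aideal A (lower_central A (Suc i))"
proof (induction i)
  case 0
  then show ?case
    by (simp add: carrier_ideal)
next
  case (Suc i)
  let ?S = "{abracket A x y |x y. x \<in> lower_central A (Suc i) \<and> y \<in> acarrier A}"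
  have "?S \<subseteq> acarrier A"
    using Suc carrier_ideal by (auto simp: aideal_def asubspace_def)
  then have sub: "asubspace A (lower_central A (Suc (Suc i)))"
    by (simp add: asubspace_aspan)
  have "abracket A x y \<in> lower_central A (Suc (Suc i)) \<and> abracket A y x \<in> lower_central A (Suc (Suc i))"
    if "x \<in> lower_central A (Suc (Suc i))" "y \<in> acarrier A" for x y
  proof -
    have x: "x \<in> lower_central A (Suc i)" "x \<in> acarrier A"
      using that lower_central_descends[OF Suc] sub by (auto simp: asubspace_def)
    then have "abracket A x y \<in> ?S"
      using that by blast
    then have "abracket A x y \<in> lower_central A (Suc (Suc i))"
      using aspan_superset[of ?S] by auto
    then show ?thesis
      using sub that x by (auto simp: bracket_antisym[of x y] asubspace_def)
  qed
  then show ?case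
    using sub by (simp add: aideal_def)
qed

lemma lie_presentation_quotient:
  assumes "aideal A I"
  shows "lie_presentation m (aquotient A I) (\<lambda>p. acoset A I (\<pi> p))"
proof -
  interpret quotient: presentation m "aquotient A I" "\<lambda>p. acoset A I (\<pi> p)"
    using assms by (rule presentation_quotient)
  show ?thesis
  proof
    show "lie_relators m \<subseteq> quotient.relations"
      using lie_relators_subset by (auto simp: relations_def quotient.relations_def)
  qed
qed

end

section \<open>The free Lie algebra and its nilpotent quotient as presented algebras\<close>

abbreviation lie_ideal :: "nat \<Rightarrow> (nat magma \<Rightarrow>\<^sub>0 'k::field) set" where
  "lie_ideal m \<equiv> aideal_gen (free_algebra m) (lie_relators m)"

interpretation free_algebra: presentation m "free_algebra m" "\<lambda>p. p" for m
  by (rule presentation_free_algebra)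

lemma aideal_free_algebra_iff:
  "aideal (free_algebra m) I \<longleftrightarrow> pm.subspace I \<and> I \<subseteq> free_carrier m
     \<and> (\<forall>x\<in>I. \<forall>y\<in>free_carrier m. free_mult x y \<in> I \<and> free_mult y x \<in> I)"
  by (auto simp: aideal_def asubspace_def pm.subspace_def)

lemma lie_relators_carrier: "lie_relators m \<subseteq> free_carrier m"
  by (auto simp: lie_relators_def)

lemma aideal_lie_ideal: "aideal (free_algebra m) (lie_ideal m :: (nat magma \<Rightarrow>\<^sub>0 'a::field) set)"
proof -
  \<comment> \<open>The whole carrier is an ideal containing the relators, so the intersection
    defining \<open>lie_ideal\<close> runs over a nonempty family and stays inside the
    carrier.\<close>
  have "aideal (free_algebra m) (free_carrier m :: (nat magma \<Rightarrow>\<^sub>0 'a) set)"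
    by (auto simp: aideal_free_algebra_iff)
  then have "(lie_ideal m :: (nat magma \<Rightarrow>\<^sub>0 'a) set) \<subseteq> free_carrier m"
    using lie_relators_carrier unfolding aideal_gen_def by (intro Inter_lower) simp
  then show ?thesis
    unfolding aideal_free_algebra_iff
    by (auto simp: aideal_gen_def aideal_free_algebra_iff pm.subspace_def)
qed

definition lie_class :: "nat \<Rightarrow> (nat magma \<Rightarrow>\<^sub>0 'k::field) \<Rightarrow> (nat magma \<Rightarrow>\<^sub>0 'k) set" where
  "lie_class m p = acoset (free_algebra m) (lie_ideal m) p"

lemma lie_class_eq_iff:
  "\<lbrakk>p \<in> free_carrier m; q \<in> free_carrier m\<rbrakk> \<Longrightarrow> lie_class m p = lie_class m q \<longleftrightarrow> p - q \<in> lie_ideal m"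
  unfolding lie_class_def
  by (rule free_algebra.acoset_eq_iff) (use aideal_lie_ideal in \<open>auto simp: aideal_def\<close>)

interpretation free_lie: lie_presentation m "free_lie m" "lie_class m" for m
proof -
  interpret presentation m "free_lie m" "lie_class m"
    using free_algebra.presentation_quotient[OF aideal_lie_ideal]
    unfolding free_lie_def lie_class_def .
  show "lie_presentation m (free_lie m) (lie_class m)"
  proof
    show "lie_relators m \<subseteq> relations"
    proof
      fix p assume "p \<in> lie_relators m"
      then have "p \<in> free_carrier m" "p \<in> lie_ideal m"
        using lie_relators_carrier by (auto simp: aideal_gen_def)
      then show "p \<in> relations"
        by (simp add: relations_def lie_class_eq_iff)
    qed
  qed
qed

definition nilpotent_class ::
  "nat \<Rightarrow> nat \<Rightarrow> (nat magma \<Rightarrow>\<^sub>0 'k::field) \<Rightarrow> (nat magma \<Rightarrow>\<^sub>0 'k) set set" where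
  "nilpotent_class k m p = acoset (free_lie m) (lower_central (free_lie m) (k + 1)) (lie_class m p)"

interpretation free_nilpotent: lie_presentation m "free_nilpotent k m" "nilpotent_class k m" for m k
  using free_lie.lie_presentation_quotient[OF free_lie.lower_central_ideal]
  unfolding free_nilpotent_def nilpotent_class_def Suc_eq_plus1 .

lemma free_nilpotent_relations:
  "free_nilpotent.relations m k =
     {p \<in> free_carrier m. lie_class m p \<in> lower_central (free_lie m) (k + 1)}"
  using free_lie.acoset_eq_iff[of m "lower_central (free_lie m) (k + 1)" _ 0]
    free_lie.lower_central_ideal[of m k]
  by (auto simp: free_nilpotent.relations_def nilpotent_class_def aideal_def)

section \<open>Left-nested products in the free algebra\<close>

primrec iterated_mult :: "nat \<Rightarrow> (nat \<Rightarrow> ('g magma \<Rightarrow>\<^sub>0 'k::field)) \<Rightarrow> ('g magma \<Rightarrow>\<^sub>0 'k)" where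
  "iterated_mult 0 p = p 0"
| "iterated_mult (Suc j) p = free_mult (iterated_mult j p) (p (Suc j))"

lemma iterated_mult_closed:
  "(\<And>i. p i \<in> free_carrier m) \<Longrightarrow> iterated_mult j p \<in> free_carrier m"
  by (induction j) auto

lemma iterated_mult_lower_central:
  assumes "\<And>i. p i \<in> free_carrier m"
  shows "lie_class m (iterated_mult j p) \<in> lower_central (free_lie m) (Suc j)"
proof (induction j)
  case 0
  then show ?case
    using assms by (simp add: free_lie.carrier)
next
  case (Suc j)
  have "abracket (free_lie m) (lie_class m (iterated_mult j p)) (lie_class m (p (Suc j)))
      \<in> lower_central (free_lie m) (Suc (Suc j))"
    using Suc assms unfolding lower_central.simps
    by (intro free_lie.aspan_superset[THEN subsetD]) (auto simp: free_lie.carrier)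
  then show ?case
    using assms by (simp add: free_lie.bracket iterated_mult_closed)
qed

text \<open>The index matches because \<open>k\<close> multiplications involve \<open>k + 1\<close>
  factors and so reach the term \<open>k + 1\<close> of the lower central series, which is what
  \<open>free_nilpotent k m\<close> divides out.\<close>

lemma iterated_mult_relation:
  "(\<And>i. p i \<in> free_carrier m) \<Longrightarrow> iterated_mult k p \<in> free_nilpotent.relations m k"
  using iterated_mult_lower_central[of p m k]
  by (simp add: free_nilpotent_relations iterated_mult_closed)

section \<open>Evaluation of words in a Lie algebra\<close>

primrec word_eval :: "('k::field, 'n) bracket \<Rightarrow> (nat \<Rightarrow> 'k ^ 'n) \<Rightarrow> nat magma \<Rightarrow> 'k ^ 'n" where
  "word_eval \<mu> x (Gen j) = x j"
| "word_eval \<mu> x (Br s t) = \<mu> (word_eval \<mu> x s) (word_eval \<mu> x t)"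

text \<open>For a Lie bracket this is the algebra homomorphism sending generator \<open>j\<close> to
  \<open>x j\<close>.\<close>

definition eval ::
  "('k::field, 'n::finite) bracket \<Rightarrow> (nat \<Rightarrow> 'k ^ 'n) \<Rightarrow> (nat magma \<Rightarrow>\<^sub>0 'k) \<Rightarrow> 'k ^ 'n" where
  "eval \<mu> x p = (\<Sum>t\<in>Poly_Mapping.keys p. Poly_Mapping.lookup p t *s word_eval \<mu> x t)"

lemma eval_superset:
  assumes "finite S" "Poly_Mapping.keys p \<subseteq> S"
  shows "eval \<mu> x p = (\<Sum>t\<in>S. Poly_Mapping.lookup p t *s word_eval \<mu> x t)"
  unfolding eval_def
  by (rule sum.mono_neutral_left) (use assms in \<open>auto simp: in_keys_iff\<close>)

lemma linear_eval: "Vector_Spaces.linear pscale (*s) (eval \<mu> x)"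
  unfolding Vector_Spaces.linear_iff
proof (intro conjI allI)
  fix p q :: "nat magma \<Rightarrow>\<^sub>0 'a" and c
  have "Poly_Mapping.keys (p + q) \<subseteq> Poly_Mapping.keys p \<union> Poly_Mapping.keys q"
    by (rule Poly_Mapping.keys_add)
  then show "eval \<mu> x (p + q) = eval \<mu> x p + eval \<mu> x q"
    by (simp add: eval_superset[of "Poly_Mapping.keys p \<union> Poly_Mapping.keys q"] lookup_add
        sum.distrib vec.scale_left_distrib)
  show "eval \<mu> x (pscale c p) = c *s eval \<mu> x p"
    by (simp add: eval_superset[of "Poly_Mapping.keys p"] keys_pscale vec.scale_sum_right)
qed unfold_locales

lemma eval_single [simp]: "eval \<mu> x (Poly_Mapping.single t c) = c *s word_eval \<mu> x t"
  by (simp add: eval_superset[of "{t}"])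

lemma eval_mult:
  assumes "lie_bracket \<mu>"
  shows "eval \<mu> x (free_mult p q) = \<mu> (eval \<mu> x p) (eval \<mu> x q)"
proof -
  interpret left: Vector_Spaces.linear "(*s)" "(*s)" "\<lambda>u. \<mu> u v" for v
    using assms by (simp add: lie_bracket_def)
  interpret right: Vector_Spaces.linear "(*s)" "(*s)" "\<lambda>v. \<mu> u v" for u
    using assms by (simp add: lie_bracket_def)
  interpret ev: Vector_Spaces.linear pscale "(*s)" "eval \<mu> x"
    by (rule linear_eval)
  show ?thesis
    unfolding free_mult_def ev.sum eval_def[of \<mu> x p] eval_def[of \<mu> x q]
    by (subst sum.swap) (simp add: left.sum right.sum left.scale right.scale vec.scale_sum_right
        mult.commute)
qed

text \<open>The kernel of a homomorphism is an ideal, and the Lie axioms of \<mu> put all relators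
  into it.\<close>

lemma eval_lie_ideal:
  assumes \<mu>: "lie_bracket \<mu>" and p: "p \<in> lie_ideal m"
  shows "eval \<mu> x p = 0"
proof -
  interpret left: Vector_Spaces.linear "(*s)" "(*s)" "\<lambda>u. \<mu> u v" for v
    using \<mu> by (simp add: lie_bracket_def)
  interpret right: Vector_Spaces.linear "(*s)" "(*s)" "\<lambda>v. \<mu> u v" for u
    using \<mu> by (simp add: lie_bracket_def)
  interpret ev: Vector_Spaces.linear pscale "(*s)" "eval \<mu> x"
    by (rule linear_eval)
  let ?K = "{p \<in> free_carrier m. eval \<mu> x p = 0}"
  have "aideal (free_algebra m) ?K"
    by (auto simp: aideal_free_algebra_iff pm.subspace_def ev.add ev.scale eval_mult[OF \<mu>]
        left.zero right.zero)
  moreover have "lie_relators m \<subseteq> ?K"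
    using \<mu> by (auto simp: lie_relators_def ev.add eval_mult[OF \<mu>] lie_bracket_def)
  ultimately show ?thesis
    using p by (auto simp: aideal_gen_def)
qed

text \<open>A term of the lower central series is a span, while the iterated bracket only gives
  individual values, hence the span in the conclusion. The induction is on the series itself: the
  classes having a representative in \<open>?X j\<close> form a subspace, so only the generating
  brackets need checking.\<close>

lemma eval_lower_central:
  assumes \<mu>: "lie_bracket \<mu>"
    and p: "p \<in> free_carrier m" "lie_class m p \<in> lower_central (free_lie m) (Suc j)"
  shows "eval \<mu> x p \<in> vec.span (range (iterated_bracket \<mu> j))"
proof -
  interpret left: Vector_Spaces.linear "(*s)" "(*s)" "\<lambda>u. \<mu> u v" for v
    using \<mu> by (simp add: lie_bracket_def)
  interpret ev: Vector_Spaces.linear pscale "(*s)" "eval \<mu> x"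
    by (rule linear_eval)
  let ?X = "\<lambda>j. {p \<in> free_carrier m. eval \<mu> x p \<in> vec.span (range (iterated_bracket \<mu> j))}"
  have "lower_central (free_lie m) (Suc j) \<subseteq> lie_class m ` ?X j"
  proof (induction j)
    case 0
    have "v \<in> vec.span (range (iterated_bracket \<mu> 0))" for v
      by (rule vec.span_base) (auto intro!: image_eqI[of _ _ "\<lambda>_. v"])
    then show ?case
      by (auto simp: free_lie.carrier)
  next
    case (Suc j)
    have "pm.subspace (?X (Suc j))"
      by (auto simp: pm.subspace_def ev.add ev.scale vec.span_add vec.span_scale vec.span_zero)
    then have sub: "asubspace (free_lie m) (lie_class m ` ?X (Suc j))"
      by (rule free_lie.asubspace_image) auto
    show ?case
      unfolding lower_central.simps
    proof (rule free_lie.aspan_minimal[OF _ sub], clarify)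
      fix X Y :: "(nat magma \<Rightarrow>\<^sub>0 'a) set"
      assume "X \<in> lower_central (free_lie m) (Suc j)" "Y \<in> acarrier (free_lie m)"
      then obtain p q where p: "X = lie_class m p" "p \<in> ?X j"
        and q: "Y = lie_class m q" "q \<in> free_carrier m"
        using Suc by (auto simp: free_lie.carrier)
      \<comment> \<open>\<open>iterated_bracket \<mu> j\<close> reads only the arguments
        \<open>0\<close> to \<open>j\<close>, so argument \<open>Suc j\<close> can be overwritten by
        \<open>eval \<mu> x q\<close>.\<close>
      have "(\<lambda>u. \<mu> u (eval \<mu> x q)) ` range (iterated_bracket \<mu> j)
          \<subseteq> range (iterated_bracket \<mu> (Suc j))"
      proof clarify
        fix y :: "nat \<Rightarrow> 'a ^ 'b"
        have "iterated_bracket \<mu> j (y(Suc j := eval \<mu> x q)) = iterated_bracket \<mu> j y"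
        proof -
          have "iterated_bracket \<mu> i (y(Suc j := eval \<mu> x q)) = iterated_bracket \<mu> i y" if "i \<le> j" for i
            using that by (induction i) auto
          then show ?thesis by simp
        qed
        then show "\<mu> (iterated_bracket \<mu> j y) (eval \<mu> x q) \<in> range (iterated_bracket \<mu> (Suc j))"
          by (intro image_eqI[of _ _ "y(Suc j := eval \<mu> x q)"]) auto
      qed
      then have "vec.span ((\<lambda>u. \<mu> u (eval \<mu> x q)) ` range (iterated_bracket \<mu> j))
          \<subseteq> vec.span (range (iterated_bracket \<mu> (Suc j)))"
        by (rule vec.span_mono)
      then have "\<mu> (eval \<mu> x p) (eval \<mu> x q) \<in> vec.span (range (iterated_bracket \<mu> (Suc j)))"
        using p by (auto simp: left.span_image)
      then show "abracket (free_lie m) X Y \<in> lie_class m ` ?X (Suc j)"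
        using p q by (auto simp: free_lie.bracket eval_mult[OF \<mu>])
    qed
  qed
  \<comment> \<open>The induction only supplies some representative \<open>q\<close> of the class of
    \<open>p\<close>; evaluation does not distinguish the two, since it kills
    \<open>lie_ideal m\<close>.\<close>
  then obtain q where q: "lie_class m p = lie_class m q" "q \<in> ?X j"
    using p by blast
  then have "p - q \<in> lie_ideal m"
    using p by (simp add: lie_class_eq_iff)
  then have "eval \<mu> x p = eval \<mu> x q"
    using eval_lie_ideal[OF \<mu>, of "p - q" m x] ev.diff by simp
  then show ?thesis
    using q by simp
qed

text \<open>In the variety the span of the previous lemma is zero. Hence evaluation factors through
  the free nilpotent Lie algebra.\<close>

lemma eval_relation:
  assumes "\<mu> \<in> nilpotent_brackets k" "p \<in> free_nilpotent.relations m k"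
  shows "eval \<mu> x p = 0"
proof -
  have "range (iterated_bracket \<mu> k) = {0}"
    using assms by (auto simp: nilpotent_brackets_def)
  moreover have "eval \<mu> x p \<in> vec.span (range (iterated_bracket \<mu> k))"
    using assms by (intro eval_lower_central) (auto simp: nilpotent_brackets_def free_nilpotent_relations)
  ultimately show ?thesis
    by simp
qed

section \<open>Bases of words\<close>

text \<open>The last two assumptions make \<pi> injective on the span of \<open>D\<close> with full
  image, so independence and spanning carry over from \<open>D\<close>.\<close>

lemma (in presentation) abasis_image:
  assumes D: "pm.independent D" "D \<subseteq> free_carrier m"
    and inter: "pm.span D \<inter> relations \<subseteq> {0}"
    and onto: "\<pi> ` pm.span D = \<pi> ` free_carrier m"
  shows "abasis A (\<pi> ` D)"
proof -
  have span: "pm.span D \<subseteq> free_carrier m"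
    using D by (simp add: pm.span_minimal)
  have inj: "p = q" if "p \<in> pm.span D" "q \<in> pm.span D" "\<pi> p = \<pi> q" for p q
  proof -
    have "p - q \<in> relations"
      using that span map_eq_iff by blast
    then show ?thesis
      using that inter pm.span_diff[of p D q] by auto
  qed
  have "\<pi> d \<notin> aspan A (\<pi> ` D - {\<pi> d})" if d: "d \<in> D" for d
  proof
    assume *: "\<pi> d \<in> aspan A (\<pi> ` D - {\<pi> d})"
    have "\<pi> ` D - {\<pi> d} = \<pi> ` (D - {d})"
      using inj d pm.span_base by blast
    then obtain q where q: "q \<in> pm.span (D - {d})" "\<pi> d = \<pi> q"
      using * D aspan_image[of "D - {d}"] by auto
    moreover have "q \<in> pm.span D"
      using q pm.span_mono[of "D - {d}" D] by blast
    ultimately have "d \<in> pm.span (D - {d})"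
      using inj[of d q] d pm.span_base by auto
    then show False
      using D d by (auto simp: pm.dependent_def)
  qed
  then show ?thesis
    unfolding abasis_def using D onto by (auto simp: carrier aspan_image)
qed

text \<open>This replaces the carrier of cosets by \<open>'k ^ 'n\<close>: on the free carrier,
  \<open>coord\<close> has the same kernel as \<pi>. Basis elements are required to be words because
  words are evaluated polynomially in the structure constants.\<close>

lemma (in presentation) coordinates_exist:
  assumes card: "CARD('n::finite) = adim (A :: ('k, 'v) na_algebra)"
  obtains w :: "'n::finite \<Rightarrow> nat magma" and coord :: "(nat magma \<Rightarrow>\<^sub>0 'k) \<Rightarrow> 'k ^ ('n::finite)"
  where "\<And>i. set_magma (w i) \<subseteq> {..<m}"
    and "Vector_Spaces.linear pscale (*s) coord"
    and "\<And>i. coord (word (w i)) = axis i 1"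
    and "\<And>p. p \<in> free_carrier m \<Longrightarrow> coord p = 0 \<longleftrightarrow> p \<in> relations"
proof -
  \<comment> \<open>A basis \<open>J\<close> of the relations is extended by words \<open>D\<close>; the quotient is then the span of \<open>D\<close>,
    and \<open>T\<close> projects onto it. The dimension may a priori be infinite: that \<open>D\<close> is finite comes
    from comparing it with the basis chosen in \<open>adim\<close>, whose cardinality is positive.\<close>
  obtain J where J: "J \<subseteq> relations" "pm.independent J" "relations \<subseteq> pm.span J"
    using pm.maximal_independent_subset by blast
  have span_J: "pm.span J = relations"
    using J pm.span_minimal[OF J(1) subspace_relations] by blast
  obtain B where B: "J \<subseteq> B" "B \<subseteq> J \<union> words m" "pm.independent B" "J \<union> words m \<subseteq> pm.span B"
    using pm.maximal_independent_subset_extend[of J "J \<union> words m"] J by blast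
  define D where "D = B - J"
  have D: "D \<subseteq> words m" "D \<subseteq> free_carrier m" "pm.independent D" "B = J \<union> D" "J \<inter> D = {}"
    using B pm.independent_mono[of B D] by (auto simp: D_def)
  have "free_carrier m \<subseteq> pm.span B"
    unfolding free_carrier_eq_span using B by (intro pm.span_minimal) auto
  then have decomp: "\<exists>a\<in>relations. \<exists>d\<in>pm.span D. p = a + d" if "p \<in> free_carrier m" for p
    using that unfolding D(4) pm.span_Un span_J by blast
  have span_D: "pm.span D \<subseteq> free_carrier m"
    using D by (simp add: pm.span_minimal)
  define T :: "(nat magma \<Rightarrow>\<^sub>0 'k) \<Rightarrow> (nat magma \<Rightarrow>\<^sub>0 'k)"
    where "T = pm_pm.construct B (\<lambda>b. if b \<in> J then 0 else b)"
  interpret T: Vector_Spaces.linear pscale pscale T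
    unfolding T_def using B by (intro pm_pm.linear_construct)
  have T_J: "T a = 0" if "a \<in> relations" for a
  proof (rule pm_pm.linear_eq_0_on_span[OF T.linear_axioms])
    show "T b = 0" if "b \<in> J" for b
      using that B by (auto simp: T_def pm_pm.construct_basis)
    show "a \<in> pm.span J"
      using that span_J by simp
  qed
  have T_D: "T d = d" if "d \<in> pm.span D" for d
  proof (rule pm_pm.linear_eq_on[OF T.linear_axioms pm.linear_id[unfolded id_def] that])
    show "T b = b" if "b \<in> D" for b
      using that B by (auto simp: T_def D_def pm_pm.construct_basis)
  qed
  have inter: "pm.span D \<inter> relations \<subseteq> {0}"
    using T_J T_D by force
  have \<pi>_T: "T p \<in> pm.span D" "\<pi> (T p) = \<pi> p" if p: "p \<in> free_carrier m" for p
  proof -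
    obtain a d where "a \<in> relations" "d \<in> pm.span D" "p = a + d"
      using decomp[OF p] by blast
    moreover from this have "T p = d"
      by (simp add: T.add T_J T_D)
    ultimately show "T p \<in> pm.span D" "\<pi> (T p) = \<pi> p"
      using p span_D map_eq_iff[of p d] by auto
  qed
  have "abasis A (\<pi> ` D)"
  proof (rule abasis_image[OF D(3,2) inter])
    show "\<pi> ` pm.span D = \<pi> ` free_carrier m"
    proof (intro equalityI subsetI)
      show "x \<in> \<pi> ` free_carrier m" if "x \<in> \<pi> ` pm.span D" for x
        using that span_D by blast
    next
      fix x assume "x \<in> \<pi> ` free_carrier m"
      then obtain p where "x = \<pi> p" "p \<in> free_carrier m"
        by blast
      then show "x \<in> \<pi> ` pm.span D"
        using \<pi>_T[of p] by (intro image_eqI[of _ _ "T p"]) auto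
    qed
  qed
  \<comment> \<open>The basis just found shows that this choice, the one counted by
    \<open>adim\<close>, really is a basis. Its elements are then lifted to a set \<open>P\<close>
    with one representative each.\<close>
  define B' where "B' = (SOME B. abasis A B)"
  have B': "abasis A B'"
    unfolding B'_def using \<open>abasis A (\<pi> ` D)\<close> by (rule someI)
  have card_B': "card B' = CARD('n)"
    using card by (simp add: adim_def B'_def)
  obtain P where P: "P \<subseteq> free_carrier m" "inj_on \<pi> P" "B' = \<pi> ` P"
    using B' by (auto simp: abasis_def carrier subset_image_inj)
  then have card_P: "card P = CARD('n)"
    using card_B' by (simp add: card_image)
  then have fin_P: "finite P"
    by (intro card_ge_0_finite) simp
  have span_P: "pm.span Q \<subseteq> free_carrier m" if "Q \<subseteq> P" for Q
    using P that by (intro pm.span_minimal) auto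
  \<comment> \<open>Since \<pi> is unchanged by \<open>T\<close>, a dependence among the projected
    representatives would be one among the elements of \<open>B'\<close>.\<close>
  have T_P: "T p \<notin> pm.span (T ` (P - {p}))" if p: "p \<in> P" for p
  proof
    assume "T p \<in> pm.span (T ` (P - {p}))"
    then obtain q where q: "q \<in> pm.span (P - {p})" "T p = T q"
      by (auto simp: T.span_image)
    then have "\<pi> p = \<pi> q"
      using \<pi>_T[of p] \<pi>_T[of q] p P span_P[of "P - {p}"] by force
    then have "\<pi> p \<in> aspan A (\<pi> ` (P - {p}))"
      using q P aspan_image[of "P - {p}"] by auto
    moreover have "\<pi> ` (P - {p}) = B' - {\<pi> p}"
      using P p by (auto simp: inj_on_def)
    ultimately show False
      using B' P p by (auto simp: abasis_def)
  qed
  have inj_T: "inj_on T P"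
  proof (rule inj_onI, rule ccontr)
    fix p q assume "p \<in> P" "q \<in> P" "T p = T q" "p \<noteq> q"
    then have "T p \<in> T ` (P - {p})"
      by (intro image_eqI[of _ _ q]) auto
    then have "T p \<in> pm.span (T ` (P - {p}))"
      by (rule pm.span_base)
    then show False
      using T_P[OF \<open>p \<in> P\<close>] by contradiction
  qed
  have ind: "pm.independent (T ` P)"
    unfolding pm.dependent_def
  proof clarify
    fix p assume p: "p \<in> P" "T p \<in> pm.span (T ` P - {T p})"
    moreover have "T ` P - {T p} = T ` (P - {p})"
      using inj_on_image_set_diff[OF inj_T, of P "{p}"] p(1) by simp
    ultimately show False
      using T_P by simp
  qed
  \<comment> \<open>An element of \<open>D\<close> agrees with some \<open>q\<close> in the span of
    \<open>P\<close> up to a relation; \<open>T\<close> removes the relation and fixes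
    \<open>D\<close>.\<close>
  have "D \<subseteq> pm.span (T ` P)"
  proof
    fix d assume d: "d \<in> D"
    then have "\<pi> d \<in> aspan A B'"
      using B' D by (auto simp: abasis_def carrier)
    then obtain q where q: "q \<in> pm.span P" "\<pi> d = \<pi> q"
      using P aspan_image[of P] by auto
    then have "d - q \<in> relations"
      using d D span_P[of P] map_eq_iff by blast
    then have "T d = T q"
      using T_J T.diff by fastforce
    then have "d = T q"
      using T_D d pm.span_base by metis
    then show "d \<in> pm.span (T ` P)"
      using q by (simp add: T.span_image)
  qed
  \<comment> \<open>The exchange bound is applied in both directions; the first application also
    gives the finiteness of \<open>D\<close> that the second one requires.\<close>
  then have fin_D: "finite D" and "card D \<le> card (T ` P)"
    using pm.independent_span_bound[OF finite_imageI[OF fin_P] D(3)] by auto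
  moreover have "T ` P \<subseteq> pm.span D"
    using P \<pi>_T by blast
  then have "card (T ` P) \<le> card D"
    using pm.independent_span_bound[OF fin_D ind] by simp
  ultimately have "card D = card (UNIV :: 'n set)"
    using card_P by (simp add: card_image inj_T)
  then obtain e :: "'n \<Rightarrow> nat magma \<Rightarrow>\<^sub>0 'k" where e: "bij_betw e UNIV D"
    using finite_same_card_bij[of "UNIV :: 'n set" D] fin_D by auto
  have "\<exists>t. e i = word t \<and> set_magma t \<subseteq> {..<m}" for i
    using e D(1) by (auto simp: bij_betw_def)
  then obtain w where w: "\<And>i. e i = word (w i)" "\<And>i. set_magma (w i) \<subseteq> {..<m}"
    by metis
  \<comment> \<open>As for \<open>T\<close>, relations go to zero, but now \<open>D\<close> is sent
    to the standard basis by inverting the enumeration \<open>e\<close>.\<close>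
  define coord :: "(nat magma \<Rightarrow>\<^sub>0 'k) \<Rightarrow> 'k ^ 'n"
    where "coord = pm_vec.construct B (\<lambda>b. if b \<in> J then 0 else axis (inv_into UNIV e b) 1)"
  have lin: "Vector_Spaces.linear pscale (*s) coord"
    unfolding coord_def using B by (intro pm_vec.linear_construct)
  interpret coord: Vector_Spaces.linear pscale "(*s)" coord
    by (rule lin)
  have coord_e: "coord (e i) = axis i 1" for i
  proof -
    have "e i \<in> D"
      using e by (auto simp: bij_betw_def)
    then have "coord (e i) = axis (inv_into UNIV e (e i)) 1"
      using B by (auto simp: coord_def D_def pm_vec.construct_basis)
    then show ?thesis
      using e by (simp add: bij_betw_def inv_into_f_f)
  qed
  have coord_J: "coord a = 0" if "a \<in> relations" for a
  proof (rule pm_vec.linear_eq_0_on_span[OF lin])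
    show "coord b = 0" if "b \<in> J" for b
      using that B by (auto simp: coord_def pm_vec.construct_basis)
    show "a \<in> pm.span J"
      using that span_J by simp
  qed
  have "p \<in> relations" if p: "p \<in> free_carrier m" "coord p = 0" for p
  proof -
    obtain a d where ad: "a \<in> relations" "d \<in> pm.span D" "p = a + d"
      using decomp[OF p(1)] by blast
    then obtain u where u: "d = (\<Sum>b\<in>D. pscale (u b) b)"
      using pm.span_finite[OF fin_D] by auto
    have d: "d = (\<Sum>i\<in>UNIV. pscale (u (e i)) (e i))"
      unfolding u using e by (rule sum.reindex_bij_betw[symmetric])
    have "coord d = 0"
      using p ad coord_J by (simp add: coord.add)
    then have "(\<Sum>i\<in>UNIV. u (e i) *s axis i 1) = (0 :: 'k ^ 'n)"
      by (simp add: d coord.sum coord.scale coord_e)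
    then have "(\<chi> i. u (e i)) = (0 :: 'k ^ 'n)"
      using basis_expansion[of "\<chi> i. u (e i)"] by simp
    then have "u (e i) = 0" for i
      by (simp add: vec_eq_iff)
    then have "d = 0"
      by (simp add: d)
    then show ?thesis
      using ad by simp
  qed
  then show ?thesis
    using that[of w coord] w lin coord_e coord_J by metis
qed

section \<open>Isomorphisms with brackets on coordinate space\<close>

lemma bracket_algebra_simps [simp]:
  "acarrier (bracket_algebra \<mu>) = UNIV" "aplus (bracket_algebra \<mu>) = (+)"
  "azero (bracket_algebra \<mu>) = 0" "ascale (bracket_algebra \<mu>) = (*s)"
  "abracket (bracket_algebra \<mu>) = \<mu>"
  by (simp_all add: bracket_algebra_def)

lemma aisomorphic_trans:
  assumes "aisomorphic A B" "aisomorphic B C"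
  shows "aisomorphic A C"
proof -
  obtain \<phi> where \<phi>: "bij_betw \<phi> (acarrier A) (acarrier B)"
      "\<And>x y. \<lbrakk>x \<in> acarrier A; y \<in> acarrier A\<rbrakk> \<Longrightarrow> \<phi> (aplus A x y) = aplus B (\<phi> x) (\<phi> y)"
      "\<And>c x. x \<in> acarrier A \<Longrightarrow> \<phi> (ascale A c x) = ascale B c (\<phi> x)"
      "\<And>x y. \<lbrakk>x \<in> acarrier A; y \<in> acarrier A\<rbrakk> \<Longrightarrow> \<phi> (abracket A x y) = abracket B (\<phi> x) (\<phi> y)"
    using assms(1) unfolding aisomorphic_def by blast
  obtain \<psi> where \<psi>: "bij_betw \<psi> (acarrier B) (acarrier C)"
      "\<And>x y. \<lbrakk>x \<in> acarrier B; y \<in> acarrier B\<rbrakk> \<Longrightarrow> \<psi> (aplus B x y) = aplus C (\<psi> x) (\<psi> y)"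
      "\<And>c x. x \<in> acarrier B \<Longrightarrow> \<psi> (ascale B c x) = ascale C c (\<psi> x)"
      "\<And>x y. \<lbrakk>x \<in> acarrier B; y \<in> acarrier B\<rbrakk> \<Longrightarrow> \<psi> (abracket B x y) = abracket C (\<psi> x) (\<psi> y)"
    using assms(2) unfolding aisomorphic_def by blast
  have "\<phi> x \<in> acarrier B" if "x \<in> acarrier A" for x
    using \<phi>(1) that by (auto simp: bij_betw_def)
  then show ?thesis
    unfolding aisomorphic_def using \<phi> \<psi> bij_betw_trans[OF \<phi>(1) \<psi>(1)]
    by (intro exI[of _ "\<psi> \<circ> \<phi>"]) simp
qed

lemma aisomorphic_bracket_algebra_iff:
  "aisomorphic (bracket_algebra \<nu>) (bracket_algebra \<mu>) \<longleftrightarrow>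
    (\<exists>\<phi>. Vector_Spaces.linear (*s) (*s) \<phi> \<and> bij \<phi> \<and> (\<forall>x y. \<phi> (\<nu> x y) = \<mu> (\<phi> x) (\<phi> y)))"
  by (auto simp: aisomorphic_def Vector_Spaces.linear_iff vec.vector_space_axioms)

lemma aisomorphic_bracket_algebra_sym:
  assumes "aisomorphic (bracket_algebra \<mu>) B"
  shows "aisomorphic B (bracket_algebra \<mu>)"
proof -
  obtain \<phi> where \<phi>: "bij_betw \<phi> UNIV (acarrier B)"
      "\<And>x y. \<phi> (x + y) = aplus B (\<phi> x) (\<phi> y)"
      "\<And>c x. \<phi> (c *s x) = ascale B c (\<phi> x)"
      "\<And>x y. \<phi> (\<mu> x y) = abracket B (\<phi> x) (\<phi> y)"
    using assms by (auto simp: aisomorphic_def)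
  have inv: "inv \<phi> (\<phi> x) = x" for x
    using \<phi>(1) by (simp add: bij_betw_def)
  have "\<exists>u. x = \<phi> u" if "x \<in> acarrier B" for x
    using \<phi>(1) that by (auto simp: bij_betw_def)
  then show ?thesis
    unfolding aisomorphic_def using bij_betw_inv_into[OF \<phi>(1)]
    by (intro exI[of _ "inv \<phi>"]) (metis \<phi>(2-4) inv bracket_algebra_simps)
qed

lemma matrix_inv_mult:
  fixes P :: "'k::field ^ 'n ^ 'n"
  assumes "invertible P"
  shows "P ** matrix_inv P = mat 1" "matrix_inv P ** P = mat 1"
  using someI_ex[of "\<lambda>Q. P ** Q = mat 1 \<and> Q ** P = mat 1"] assms
  by (auto simp: invertible_def matrix_inv_def)

text \<open>If \<nu> is obtained from \<mu> by \<open>g\<close>, the isomorphism from \<nu> to \<mu>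
  is the inverse of \<open>g\<close>. Conversely, \<open>g\<close> is the inverse of the matrix of
  the isomorphism.\<close>

lemma gl_orbit_iff:
  fixes \<nu> \<mu> :: "('k::field, 'n::finite) bracket"
  shows "\<nu> \<in> gl_orbit \<mu> \<longleftrightarrow> aisomorphic (bracket_algebra \<nu>) (bracket_algebra \<mu>)"
proof
  assume "\<nu> \<in> gl_orbit \<mu>"
  then obtain g where g: "invertible g" "\<nu> = gl_action g \<mu>"
    by (auto simp: gl_orbit_def)
  have inv: "matrix_inv g *v (g *v x) = x" "g *v (matrix_inv g *v x) = x" for x
    using matrix_inv_mult[OF g(1)] by (simp_all add: matrix_vector_mul_assoc)
  then have "bij ((*v) (matrix_inv g))"
    by (intro o_bij[of "(*v) g"]) (auto simp: fun_eq_iff)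
  then show "aisomorphic (bracket_algebra \<nu>) (bracket_algebra \<mu>)"
    unfolding aisomorphic_bracket_algebra_iff
    by (intro exI[of _ "(*v) (matrix_inv g)"]) (simp add: g gl_action_def inv)
next
  assume "aisomorphic (bracket_algebra \<nu>) (bracket_algebra \<mu>)"
  then obtain \<phi> where \<phi>: "Vector_Spaces.linear (*s) (*s) \<phi>" "bij \<phi>"
      "\<And>x y. \<phi> (\<nu> x y) = \<mu> (\<phi> x) (\<phi> y)"
    by (auto simp: aisomorphic_bracket_algebra_iff)
  define P where "P = matrix \<phi>"
  have P: "P *v x = \<phi> x" for x
    unfolding P_def using \<phi>(1) by (rule matrix_works)
  then have "(*v) P = \<phi>"
    by (rule ext)
  then have "inj ((*v) P)"
    using \<phi>(2) by (simp add: bij_is_inj)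
  then have "invertible P"
    by (simp add: invertible_left_inverse matrix_left_invertible_injective)
  then have inv: "P ** matrix_inv P = mat 1" "matrix_inv P ** P = mat 1"
    by (simp_all add: matrix_inv_mult)
  then have g: "invertible (matrix_inv P)"
    by (auto simp: invertible_def)
  have "matrix_inv (matrix_inv P) = P"
    using matrix_inv_mult[OF g] inv by (metis matrix_mul_assoc matrix_mul_lid matrix_mul_rid)
  moreover have "matrix_inv P *v \<phi> x = x" for x
    by (simp add: matrix_vector_mul_assoc inv flip: P)
  ultimately have "\<nu> = gl_action (matrix_inv P) \<mu>"
    by (simp add: gl_action_def P fun_eq_iff flip: \<phi>(3))
  then show "\<nu> \<in> gl_orbit \<mu>"
    using g by (auto simp: gl_orbit_def)
qed

section \<open>Transport of the Lie and nilpotency conditions along an isomorphism\<close>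

lemma (in presentation) isomorphismE:
  assumes "aisomorphic (bracket_algebra \<mu>) A"
  obtains \<phi> where "inj \<phi>" "range \<phi> = \<pi> ` free_carrier m"
    "\<phi> 0 = \<pi> 0"
    "\<And>x y. \<phi> (x + y) = aplus A (\<phi> x) (\<phi> y)"
    "\<And>c x. \<phi> (c *s x) = ascale A c (\<phi> x)"
    "\<And>x y. \<phi> (\<mu> x y) = abracket A (\<phi> x) (\<phi> y)"
    "\<And>v. \<exists>p\<in>free_carrier m. \<phi> v = \<pi> p"
proof -
  obtain \<phi> where \<phi>: "bij_betw \<phi> UNIV (\<pi> ` free_carrier m)"
      "\<And>x y. \<phi> (x + y) = aplus A (\<phi> x) (\<phi> y)"
      "\<And>c x. \<phi> (c *s x) = ascale A c (\<phi> x)"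
      "\<And>x y. \<phi> (\<mu> x y) = abracket A (\<phi> x) (\<phi> y)"
    using assms by (auto simp: aisomorphic_def carrier)
  have ex: "\<exists>p\<in>free_carrier m. \<phi> v = \<pi> p" for v
    using \<phi>(1) by (auto simp: bij_betw_def)
  \<comment> \<open>\<open>aisomorphic\<close> does not mention zero; its preservation comes from
    scaling by the scalar 0.\<close>
  then obtain p where "p \<in> free_carrier m" "\<phi> 0 = \<pi> p"
    by blast
  then have "\<phi> 0 = \<pi> 0"
    using \<phi>(3)[of 0 0] by (simp add: scale)
  then show ?thesis
    using that \<phi> ex by (auto simp: bij_betw_def)
qed

text \<open>Each axiom is checked after applying the isomorphism, on representatives, where it
  follows from bilinearity of \<open>free_mult\<close> or is a known relation. Injectivity brings it
  back.\<close>

lemma (in lie_presentation) lie_bracket_if_isomorphic: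
  assumes "aisomorphic (bracket_algebra \<mu>) A"
  shows "lie_bracket \<mu>"
proof -
  obtain \<phi> where \<phi>: "inj \<phi>" "range \<phi> = \<pi> ` free_carrier m" "\<phi> 0 = \<pi> 0"
    "\<And>x y. \<phi> (x + y) = aplus A (\<phi> x) (\<phi> y)"
    "\<And>c x. \<phi> (c *s x) = ascale A c (\<phi> x)"
    "\<And>x y. \<phi> (\<mu> x y) = abracket A (\<phi> x) (\<phi> y)"
    and ex: "\<And>v. \<exists>p\<in>free_carrier m. \<phi> v = \<pi> p"
    by (rule isomorphismE[OF assms], rule that)
  note simps = \<phi>(3-) plus scale bracket
  have "\<phi> (\<mu> x (y + z)) = \<phi> (\<mu> x y + \<mu> x z)" "\<phi> (\<mu> (y + z) x) = \<phi> (\<mu> y x + \<mu> z x)"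
    "\<phi> (\<mu> x (c *s y)) = \<phi> (c *s \<mu> x y)" "\<phi> (\<mu> (c *s y) x) = \<phi> (c *s \<mu> y x)"
    "\<phi> (\<mu> x x) = \<phi> 0" "\<phi> (\<mu> (\<mu> x y) z + \<mu> (\<mu> y z) x + \<mu> (\<mu> z x) y) = \<phi> 0" for x y z c
  proof -
    obtain p q r where pqr: "p \<in> free_carrier m" "q \<in> free_carrier m" "r \<in> free_carrier m"
      and eqs: "\<phi> x = \<pi> p" "\<phi> y = \<pi> q" "\<phi> z = \<pi> r"
      using ex by metis
    show "\<phi> (\<mu> x (y + z)) = \<phi> (\<mu> x y + \<mu> x z)" "\<phi> (\<mu> (y + z) x) = \<phi> (\<mu> y x + \<mu> z x)"
      "\<phi> (\<mu> x (c *s y)) = \<phi> (c *s \<mu> x y)" "\<phi> (\<mu> (c *s y) x) = \<phi> (c *s \<mu> y x)"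
      "\<phi> (\<mu> x x) = \<phi> 0" "\<phi> (\<mu> (\<mu> x y) z + \<mu> (\<mu> y z) x + \<mu> (\<mu> z x) y) = \<phi> 0"
      by (simp_all add: simps eqs pqr free_mult_add_left free_mult_add_right free_mult_scale_left
          free_mult_scale_right map_eq_zero_iff square_relation jacobi_relation)
  qed
  then show ?thesis
    unfolding inj_eq[OF \<phi>(1)]
    by (auto simp: lie_bracket_def Vector_Spaces.linear_iff vec.vector_space_axioms)
qed

text \<open>Lifting the arguments to representatives turns an iterated bracket into
  \<open>iterated_mult\<close>, which is a relation at index \<open>k\<close>.\<close>

lemma nilpotent_bracket_if_isomorphic:
  assumes iso: "aisomorphic (bracket_algebra \<mu>) (free_nilpotent k m)"
  shows "\<mu> \<in> nilpotent_brackets k"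
proof -
  obtain \<phi> where \<phi>: "inj \<phi>" "range \<phi> = nilpotent_class k m ` free_carrier m" "\<phi> 0 = nilpotent_class k m 0"
    "\<And>x y. \<phi> (x + y) = aplus (free_nilpotent k m) (\<phi> x) (\<phi> y)"
    "\<And>c x. \<phi> (c *s x) = ascale (free_nilpotent k m) c (\<phi> x)"
    "\<And>x y. \<phi> (\<mu> x y) = abracket (free_nilpotent k m) (\<phi> x) (\<phi> y)"
    and ex: "\<And>v. \<exists>p\<in>free_carrier m. \<phi> v = nilpotent_class k m p"
    by (rule free_nilpotent.isomorphismE[OF iso], rule that)
  obtain l where l: "\<And>v. l v \<in> free_carrier m" "\<And>v. \<phi> v = nilpotent_class k m (l v)"
    using ex by metis
  have "\<phi> (iterated_bracket \<mu> j x) = nilpotent_class k m (iterated_mult j (\<lambda>i. l (x i)))" for j x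
    by (induction j)
      (simp_all add: \<phi>(6) free_nilpotent.bracket iterated_mult_closed l(1) l(2)[of "x i" for i])
  then have "\<phi> (iterated_bracket \<mu> k x) = \<phi> 0" for x
    using iterated_mult_relation[of "\<lambda>i. l (x i)" m k] l(1) \<phi>(3)
    by (simp add: free_nilpotent.relations_def)
  then have "iterated_bracket \<mu> k x = 0" for x
    by (rule injD[OF \<phi>(1)])
  then show ?thesis
    using free_nilpotent.lie_bracket_if_isomorphic[OF iso] by (simp add: nilpotent_brackets_def)
qed

section \<open>Coordinates on a presented Lie algebra\<close>

locale coordinates = lie_presentation m A \<pi>
  for m and A :: "('k::field, 'v) na_algebra" and \<pi> +
  fixes w :: "'n::finite \<Rightarrow> nat magma" and coord :: "(nat magma \<Rightarrow>\<^sub>0 'k) \<Rightarrow> 'k ^ 'n"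
  assumes w: "set_magma (w i) \<subseteq> {..<m}"
    and linear_coord: "Vector_Spaces.linear pscale (*s) coord"
    and coord_word: "coord (word (w i)) = axis i 1"
    and coord_eq_zero_iff: "p \<in> free_carrier m \<Longrightarrow> coord p = 0 \<longleftrightarrow> p \<in> relations"
begin

sublocale coord: Vector_Spaces.linear pscale "(*s)" coord
  by (rule linear_coord)

text \<open>The linear section of \<open>coord\<close> with values in the span of the chosen
  words.\<close>

definition rep :: "'k ^ 'n \<Rightarrow> (nat magma \<Rightarrow>\<^sub>0 'k)" where
  "rep v = (\<Sum>i\<in>UNIV. Poly_Mapping.single (w i) (v $ i))"

lemma rep_closed [simp]: "rep v \<in> free_carrier m"
  unfolding rep_def using w by (intro pm.subspace_sum) (auto intro: single_in_free_carrier)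

lemma rep_add: "rep (u + v) = rep u + rep v"
  by (simp add: rep_def single_add sum.distrib)

lemma rep_scale: "rep (c *s v) = pscale c (rep v)"
  by (simp add: rep_def pm.scale_sum_right)

lemma coord_rep [simp]: "coord (rep v) = v"
proof -
  have "coord (Poly_Mapping.single (w i) c) = c *s axis i 1" for i c
    using coord.scale[of c "word (w i)"] by (simp add: coord_word)
  then show ?thesis
    by (simp add: rep_def coord.sum basis_expansion)
qed

lemma coord_eq_iff: "\<lbrakk>p \<in> free_carrier m; q \<in> free_carrier m\<rbrakk> \<Longrightarrow> coord p = coord q \<longleftrightarrow> \<pi> p = \<pi> q"
  using coord_eq_zero_iff[of "p - q"] by (simp add: map_eq_iff coord.diff)

lemma rep_coord_relation: "p \<in> free_carrier m \<Longrightarrow> rep (coord p) - p \<in> relations"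
  by (simp add: coord.diff flip: coord_eq_zero_iff)

definition coord_bracket :: "('k, 'n) bracket" where
  "coord_bracket u v = coord (free_mult (rep u) (rep v))"

text \<open>Transport of structure: \<open>rep\<close> followed by \<pi> is inverse to the map that
  \<open>coord\<close> induces on \<open>A\<close>. This provides a bracket on coordinate space
  isomorphic to \<open>A\<close>.\<close>

lemma aisomorphic_coord_bracket: "aisomorphic (bracket_algebra coord_bracket) A"
  unfolding aisomorphic_def
proof (intro exI[of _ "\<lambda>v. \<pi> (rep v)"] conjI ballI allI)
  have eq: "\<pi> (rep u) = \<pi> p \<longleftrightarrow> u = coord p" if "p \<in> free_carrier m" for u p
    using that by (simp flip: coord_eq_iff)
  have "\<pi> p \<in> range (\<lambda>v. \<pi> (rep v))" if "p \<in> free_carrier m" for p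
    using eq[OF that] by (metis rangeI)
  then show "bij_betw (\<lambda>v. \<pi> (rep v)) (acarrier (bracket_algebra coord_bracket)) (acarrier A)"
    by (auto simp: bij_betw_def inj_on_def carrier eq)
  fix u v c
  show "\<pi> (rep (aplus (bracket_algebra coord_bracket) u v)) = aplus A (\<pi> (rep u)) (\<pi> (rep v))"
    by (simp add: rep_add plus)
  show "\<pi> (rep (ascale (bracket_algebra coord_bracket) c u)) = ascale A c (\<pi> (rep u))"
    by (simp add: rep_scale scale)
  show "\<pi> (rep (abracket (bracket_algebra coord_bracket) u v)) =
      abracket A (\<pi> (rep u)) (\<pi> (rep v))"
    by (simp add: coord_bracket_def bracket eq)
qed

abbreviation word_matrix :: "('k, 'n) bracket \<Rightarrow> (nat \<Rightarrow> 'k ^ 'n) \<Rightarrow> 'k ^ 'n ^ 'n" where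
  "word_matrix \<mu> x \<equiv> (\<chi> i. word_eval \<mu> x (w i))"

text \<open>The word values are the rows of \<open>word_matrix\<close>, hence the transpose. Thus
  the determinant decides whether evaluation is invertible in coordinates.\<close>

lemma eval_rep: "eval \<mu> x (rep v) = transpose (word_matrix \<mu> x) *v v"
proof -
  interpret ev: Vector_Spaces.linear pscale "(*s)" "eval \<mu> x"
    by (rule linear_eval)
  show ?thesis
    by (simp add: rep_def ev.sum vec_eq_iff matrix_vector_mult_def transpose_def mult.commute)
qed

text \<open>Because evaluation kills relations, \<open>rep (coord p)\<close> may be replaced by
  \<open>p\<close> inside it. This makes the matrix of evaluation a homomorphism from
  \<open>coord_bracket\<close> to \<mu>, and the determinant makes it bijective.\<close>

lemma aisomorphic_if_generated:
  assumes \<mu>: "lie_bracket \<mu>" "\<And>p. p \<in> relations \<Longrightarrow> eval \<mu> x p = 0"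
    and det: "det (word_matrix \<mu> x) \<noteq> 0"
  shows "aisomorphic (bracket_algebra \<mu>) A"
proof -
  interpret ev: Vector_Spaces.linear pscale "(*s)" "eval \<mu> x"
    by (rule linear_eval)
  define N where "N = transpose (word_matrix \<mu> x)"
  have eval_N: "N *v v = eval \<mu> x (rep v)" for v
    unfolding N_def by (rule eval_rep[symmetric])
  have N: "invertible N"
    using det by (simp add: invertible_det_nz N_def)
  have "bij ((*v) N)"
    by (rule o_bij[of "(*v) (matrix_inv N)"])
      (simp_all add: fun_eq_iff matrix_vector_mul_assoc matrix_inv_mult[OF N])
  moreover have "eval \<mu> x (rep (coord p)) = eval \<mu> x p" if "p \<in> free_carrier m" for p
    using \<mu>(2)[OF rep_coord_relation[OF that]] by (simp add: ev.diff)
  then have "N *v coord_bracket u v = \<mu> (N *v u) (N *v v)" for u v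
    by (simp add: coord_bracket_def eval_mult[OF \<mu>(1)] eval_N)
  ultimately have "aisomorphic (bracket_algebra coord_bracket) (bracket_algebra \<mu>)"
    unfolding aisomorphic_bracket_algebra_iff by (intro exI[of _ "(*v) N"]) simp
  then show ?thesis
    using aisomorphic_bracket_algebra_sym aisomorphic_trans aisomorphic_coord_bracket by blast
qed

text \<open>Taking for \<open>x\<close> the preimages of the classes of the generators, evaluation
  followed by \<phi> is \<pi>. Since \<open>rep\<close> meets the kernel of \<pi> only in zero,
  evaluation is injective on the chosen words' span.\<close>

lemma generated_if_aisomorphic:
  assumes iso: "aisomorphic (bracket_algebra \<mu>) A"
  shows "\<exists>x. det (word_matrix \<mu> x) \<noteq> 0"
proof -
  obtain \<phi> where \<phi>: "inj \<phi>" "range \<phi> = \<pi> ` free_carrier m" "\<phi> 0 = \<pi> 0"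
    "\<And>x y. \<phi> (x + y) = aplus A (\<phi> x) (\<phi> y)"
    "\<And>c x. \<phi> (c *s x) = ascale A c (\<phi> x)"
    "\<And>x y. \<phi> (\<mu> x y) = abracket A (\<phi> x) (\<phi> y)"
    and ex: "\<And>v. \<exists>p\<in>free_carrier m. \<phi> v = \<pi> p"
    by (rule isomorphismE[OF iso], rule that)
  \<comment> \<open>For \<open>j \<ge> m\<close> the value is arbitrary; the words considered only
    have letters below \<open>m\<close>.\<close>
  define x where "x j = inv \<phi> (\<pi> (word (Gen j)))" for j
  have x: "\<phi> (x j) = \<pi> (word (Gen j))" if "j < m" for j
    unfolding x_def by (rule f_inv_into_f) (use that in \<open>simp add: \<phi>(2)\<close>)
  interpret ev: Vector_Spaces.linear pscale "(*s)" "eval \<mu> x"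
    by (rule linear_eval)
  have word: "\<phi> (word_eval \<mu> x t) = \<pi> (word t)" if "set_magma t \<subseteq> {..<m}" for t
    using that by (induction t) (simp_all add: x \<phi>(6) bracket)
  have eval: "\<phi> (eval \<mu> x p) = \<pi> p" if "p \<in> free_carrier m" for p
  proof -
    have "pm.subspace {p \<in> free_carrier m. \<phi> (eval \<mu> x p) = \<pi> p}"
      by (auto simp: pm.subspace_def ev.add ev.scale \<phi>(3-5) plus scale)
    moreover have "words m \<subseteq> {p \<in> free_carrier m. \<phi> (eval \<mu> x p) = \<pi> p}"
      by (auto simp: word)
    ultimately show ?thesis
      using that pm.span_minimal unfolding free_carrier_eq_span by blast
  qed
  have "v = 0" if "transpose (word_matrix \<mu> x) *v v = 0" for v
  proof -
    have "\<pi> (rep v) = \<pi> 0"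
      using eval[of "rep v"] that \<phi>(3) by (simp add: eval_rep)
    then show "v = 0"
      using coord_eq_iff[of "rep v" 0] by (simp add: coord.zero)
  qed
  then have "invertible (transpose (word_matrix \<mu> x))"
    by (simp add: invertible_left_inverse matrix_left_invertible_ker)
  then show ?thesis
    by (auto simp: invertible_det_nz)
qed

end

section \<open>Polynomial conditions on structure constants\<close>

definition polynomial_function :: "(('i::finite \<Rightarrow> 'k::field) \<Rightarrow> 'k) \<Rightarrow> bool" where
  "polynomial_function F \<longleftrightarrow> (\<exists>f. \<forall>s. F s = peval f s)"

lemma polynomial_function_const: "polynomial_function (\<lambda>_. c)"
  unfolding polynomial_function_def
  by (rule exI[of _ "Poly_Mapping.single 0 c"]) (simp add: peval_single)

lemma polynomial_function_var: "polynomial_function (\<lambda>s. s i)"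
proof -
  have "(\<Prod>j\<in>UNIV. s j ^ (1 when i = j)) = (\<Prod>j\<in>UNIV. if i = j then s j else 1)" for s :: "'a \<Rightarrow> 'b"
    by (rule prod.cong) auto
  then show ?thesis
    unfolding polynomial_function_def
    by (intro exI[of _ "Poly_Mapping.single (Poly_Mapping.single i 1) 1"])
      (simp add: peval_single lookup_single)
qed

lemma polynomial_function_add:
  "\<lbrakk>polynomial_function F; polynomial_function G\<rbrakk> \<Longrightarrow> polynomial_function (\<lambda>s. F s + G s)"
  unfolding polynomial_function_def by (metis peval_add)

lemma polynomial_function_mult:
  "\<lbrakk>polynomial_function F; polynomial_function G\<rbrakk> \<Longrightarrow> polynomial_function (\<lambda>s. F s * G s)"
  unfolding polynomial_function_def by (metis peval_mult)

lemma polynomial_function_sum: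
  "(\<And>j. j \<in> J \<Longrightarrow> polynomial_function (F j)) \<Longrightarrow> polynomial_function (\<lambda>s. \<Sum>j\<in>J. F j s)"
  by (induction J rule: infinite_finite_induct)
    (auto intro: polynomial_function_add polynomial_function_const)

lemma polynomial_function_prod:
  "(\<And>j. j \<in> J \<Longrightarrow> polynomial_function (F j)) \<Longrightarrow> polynomial_function (\<lambda>s. \<Prod>j\<in>J. F j s)"
  by (induction J rule: infinite_finite_induct)
    (auto intro: polynomial_function_mult polynomial_function_const)

lemmas polynomial_function_intros = polynomial_function_const polynomial_function_var
  polynomial_function_add polynomial_function_mult polynomial_function_sum polynomial_function_prod

text \<open>The bilinear map with prescribed structure constants. It is defined at every point of
  affine space, on or off the variety, so that the determinants become polynomials on the whole
  space.\<close>

definition bracket_of :: "('n \<times> 'n \<times> 'n \<Rightarrow> 'k) \<Rightarrow> ('k::field, 'n::finite) bracket" where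
  "bracket_of s u v = (\<chi> l. \<Sum>i\<in>UNIV. \<Sum>j\<in>UNIV. u $ i * v $ j * s (i, j, l))"

lemma bracket_of_structure_constants:
  assumes "lie_bracket \<mu>"
  shows "bracket_of (structure_constants \<mu>) = \<mu>"
proof (intro ext)
  fix u v
  interpret left: Vector_Spaces.linear "(*s)" "(*s)" "\<lambda>u. \<mu> u v" for v
    using assms by (simp add: lie_bracket_def)
  interpret right: Vector_Spaces.linear "(*s)" "(*s)" "\<lambda>v. \<mu> u v" for u
    using assms by (simp add: lie_bracket_def)
  have "\<mu> u v = \<mu> (\<Sum>i\<in>UNIV. u $ i *s axis i 1) (\<Sum>j\<in>UNIV. v $ j *s axis j 1)"
    by (simp add: basis_expansion)
  also have "\<dots> = (\<Sum>i\<in>UNIV. \<Sum>j\<in>UNIV. (u $ i * v $ j) *s \<mu> (axis i 1) (axis j 1))"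
    by (subst sum.swap) (simp add: left.sum left.scale right.sum right.scale vec.scale_sum_right
        mult.commute)
  finally show "bracket_of (structure_constants \<mu>) u v = \<mu> u v"
    by (simp add: bracket_of_def structure_constants_def vec_eq_iff)
qed

text \<open>The vectors \<open>x\<close> are constants here. The coordinate \<open>l\<close> is
  generalised because one coordinate of a bracket involves all coordinates of its two
  factors.\<close>

lemma polynomial_function_word_eval: "polynomial_function (\<lambda>s. word_eval (bracket_of s) x t $ l)"
  by (induction t arbitrary: l) (auto simp: bracket_of_def intro!: polynomial_function_intros)

lemma polynomial_function_det:
  "(\<And>i j. polynomial_function (\<lambda>s. M s $ i $ j)) \<Longrightarrow> polynomial_function (\<lambda>s. det (M s))"
  unfolding det_def by (intro polynomial_function_intros)

text \<open>The first conjunct says that a choice of basis exists; the second treats every such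
  choice. Since \<open>CARD('n)\<close> is positive, the default value 0 of \<open>adim\<close>
  cannot satisfy the dimension hypothesis.\<close>

theorem theorem4p3:
  fixes k m :: nat
  assumes "k \<ge> 1" and "m \<ge> 2"
    and "CARD('n::finite) =
      adim (free_nilpotent k m :: ('k::{alg_closed_field, field_char_0}, _) na_algebra)"
  shows "(\<exists>\<mu> :: ('k, 'n) bracket. aisomorphic (bracket_algebra \<mu>) (free_nilpotent k m)) \<and>
    (\<forall>\<mu> :: ('k, 'n) bracket.
      aisomorphic (bracket_algebra \<mu>) (free_nilpotent k m) \<longrightarrow> rigid k \<mu>)"
proof -
  let ?A = "free_nilpotent k m :: ('k, _) na_algebra"
  obtain w :: "'n \<Rightarrow> nat magma" and coord :: "(nat magma \<Rightarrow>\<^sub>0 'k) \<Rightarrow> 'k ^ 'n"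
    where coords: "\<And>i. set_magma (w i) \<subseteq> {..<m}"
        "Vector_Spaces.linear pscale (*s) coord"
        "\<And>i. coord (word (w i)) = axis i 1"
        "\<And>p. p \<in> free_carrier m \<Longrightarrow> coord p = 0 \<longleftrightarrow> p \<in> free_nilpotent.relations m k"
    by (rule free_nilpotent.coordinates_exist[OF assms(3)], rule that)
  interpret coordinates m ?A "nilpotent_class k m" w coord
    by (intro coordinates.intro coordinates_axioms.intro free_nilpotent.lie_presentation_axioms)
      (fact coords)+
  \<comment> \<open>From left to right, the generators of \<open>?A\<close> supply \<open>x\<close>.
    From right to left, membership in the variety makes evaluation at \<open>x\<close> vanish on all
    relations.\<close>
  have iso_iff: "aisomorphic (bracket_algebra \<nu>) ?A \<longleftrightarrow>
      \<nu> \<in> nilpotent_brackets k \<and> (\<exists>x. det (word_matrix \<nu> x) \<noteq> 0)" for \<nu> :: "('k, 'n) bracket"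
  proof
    assume "aisomorphic (bracket_algebra \<nu>) ?A"
    then show "\<nu> \<in> nilpotent_brackets k \<and> (\<exists>x. det (word_matrix \<nu> x) \<noteq> 0)"
      using nilpotent_bracket_if_isomorphic generated_if_aisomorphic by blast
  next
    assume "\<nu> \<in> nilpotent_brackets k \<and> (\<exists>x. det (word_matrix \<nu> x) \<noteq> 0)"
    then obtain x where \<nu>: "\<nu> \<in> nilpotent_brackets k" and x: "det (word_matrix \<nu> x) \<noteq> 0"
      by blast
    show "aisomorphic (bracket_algebra \<nu>) ?A"
      by (rule aisomorphic_if_generated[OF _ eval_relation[OF \<nu>] x])
        (use \<nu> in \<open>simp add: nilpotent_brackets_def\<close>)
  qed
  have "\<exists>f. \<forall>s. det (word_matrix (bracket_of s) x) = peval f s" for x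
    using polynomial_function_det[of "\<lambda>s. word_matrix (bracket_of s) x"]
    by (simp add: polynomial_function_word_eval flip: polynomial_function_def)
  then obtain f where f: "\<And>x s. det (word_matrix (bracket_of s) x) = peval (f x) s"
    by metis
  define U where "U = - {s. \<forall>h\<in>range f. peval h s = 0}"
  have "rigid k \<mu>" if \<mu>: "aisomorphic (bracket_algebra \<mu>) ?A" for \<mu> :: "('k, 'n) bracket"
  proof -
    \<comment> \<open>The orbit is the full isomorphism class of \<open>?A\<close> and so does not
      depend on the basis that produced \<mu>.\<close>
    have orbit: "gl_orbit \<mu> = {\<nu>. aisomorphic (bracket_algebra \<nu>) ?A}"
      using aisomorphic_trans[OF _ \<mu>] aisomorphic_trans[OF _ aisomorphic_bracket_algebra_sym[OF \<mu>]]
      by (auto simp: gl_orbit_iff)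
    \<comment> \<open>Points of the variety come from bilinear maps, which \<open>bracket_of\<close>
      recovers from their structure constants; there the polynomials \<open>f x\<close> are the
      actual determinants.\<close>
    have "structure_constants \<nu> \<in> U \<longleftrightarrow> (\<exists>x. det (word_matrix \<nu> x) \<noteq> 0)"
      if "\<nu> \<in> nilpotent_brackets k" for \<nu> :: "('k, 'n) bracket"
      using that by (simp add: U_def nilpotent_brackets_def bracket_of_structure_constants flip: f)
    then have "structure_constants ` gl_orbit \<mu> = U \<inter> structure_constants ` nilpotent_brackets k"
      by (auto simp: orbit iso_iff)
    moreover have "openin zariski U"
      unfolding openin_zariski U_def by (rule exI[of _ "range f"]) (rule refl)
    ultimately show ?thesis
      using \<mu> iso_iff unfolding rigid_def openin_subtopology by blast
  qed
  then show ?thesis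
    using aisomorphic_coord_bracket by blast
qed

end
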